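(* Let $\rho(f) \in [0,1)$ denote the rotation number of $f: \mathbb{T} \to \mathbb{T}$. (i) If $\rho(f) \not\in \mathbb{Q}$, $f$ is topologically conjugate to the rotation $x \mapsto x + \rho(f) \pmod 1$ on $\mathbb{T}$. In particular $f$ is minimal (all orbits are dense). (ii) If $\rho(f) \in \mathbb{Q}$, write $\rho(f) = p/q$, where, if $\rho(f)>0$, $p,q$ are coprime positive integers, else $p=0,q=1$. There exist two sets $\mathcal{P}^\pm := \bigcup_{i=0}^{q-1} \mathcal{P}_i^\pm$, where the $\mathcal{P}_i^\pm$ are closed intervals. All points in $\mathcal{P}^\pm$ are $q$-periodic and, for all $i \in \mathbb{Z}_q$ and $n \in \mathbb{N}$, $f^n(\mathcal{P}_i^\pm) = \mathcal{P}_{i+pn}^\pm$. All points in $\mathbb{T} \setminus (\mathcal{P}^+ \cup \mathcal{P}^-)$ are non-periodic. Only two possibilities are given: (a) Each $\mathcal{P}_i^\pm$ reduces to a point $x_i^\pm$, ordered according to the orientation of $\mathbb{T}$ as $x_0^- \le x_0^+ \le x_1^- \le x_1^+ \le \cdots \le x_{q-1}^- \le x_{q-1}^+ \le x_0^-$. So $\mathcal{O}^\pm := \{x_0^\pm,\ldots,x_{q-1}^\pm\}$ are two (possibly coinciding) periodic orbits with $f^n(x_i^\pm)=x_{i+pn}^\pm$. For $x\in(x_i^-,x_i^+)$: $f^n(x)\in(x_{i+pn}^-,x_{i+pn}^+)$, $\lim_{n\to+\infty}f^{nq}(x)=x_i^+$, $\lim_{n\to-\infty}f^{nq}(x)=x_i^-$.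 For $x\in(x_i^+,x_{i+1}^-)$: $f^n(x)\in(x_{i+pn}^+,x_{i+1+pn}^-)$, $\lim_{n\to+\infty}f^{nq}(x)=x_i^+$, $\lim_{n\to-\infty}f^{nq}(x)=x_{i+1}^-$. Hence $\mathcal{O}^+$, resp. $\mathcal{O}^-$, is the global attractor, resp. repellor. (b) All $\mathcal{P}_i^\pm$ are non-degenerate intervals with $\mathcal{P}_i^+=\mathcal{P}_i^-=:[x_i^L,x_i^R]$, and $x_0^L < x_0^R \le x_1^L < x_1^R \le \cdots \le x_{q-1}^L < x_{q-1}^R \le x_0^L$, where $x_i^R<x_{i+1}^L$ holds for some $i$ iff it holds for all $i$. (1) If $x_i^R<x_{i+1}^L$ for all $i$, then for $x\in(x_i^R,x_{i+1}^L)$: $f^n(x)\in(x_{i+pn}^R,x_{i+1+pn}^L)$, $\lim_{n\to+\infty}f^{nq}(x)=x_i^R$, $\lim_{n\to-\infty}f^{nq}(x)=x_{i+1}^L$; so $\{x_i^R\}$ and $\{x_i^L\}$ are the unique (not global) attractor and repellor. (2) If $x_i^R=x_{i+1}^L$ for all $i$, all orbits are periodic. If moreover the right side of the table contains no segment (equivalently $b$ is strictly concave), case (b) cannot occur.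
   Context: Setting: an internal-wave billiard (unit-speed point particle in a planar table, reflected so that the angles of incident and reflected velocities with the vertical are equal) in a table $D$ of height $1/2$ with horizontal bases, a vertical left side, and right side the graph of a piecewise $C^1$, strictly decreasing, concave function (possibly plus a vertical segment at its lower end). The dynamics is unfolded to a unit-speed linear flow of direction $\theta\in(\alpha_M,\pi/2)$ on a 4-fold copy $\hat D$ of $D$ whose upper boundary is the graph of an even, piecewise $C^1$, concave function $b:[-1/2,1/2]\to\mathbb{R}^+$ non-increasing on $[0,1/2]$ (lower boundary its mirror image), opposite boundary points identified; $\alpha_M=\arctan b'(-1/2)$. $f$ is the first-return map of this flow to a horizontal cross-section $\Sigma$ of length 1, identified with the circle $\mathbb{T}=\mathbb{R}/\mathbb{Z}$; $f$ is an orientation-preserving homeomorphism. The rotation number is $\rho(f)=\lim_{n\to\infty}(F^n(x)-x)/n \bmod 1$ for a lift $F:\mathbb{R}\to\mathbb{R}$ of $f$. $\mathbb{Z}_q=\mathbb{Z}/q\mathbb{Z}$ denotes cyclic indices (sums of indices taken mod $q$). *)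

theory Defs
  imports "HOL-Analysis.Analysis"
begin

definition circ :: "real \<Rightarrow> complex" where
  "circ t = cis (2 * pi * t)"

abbreviation Tcirc :: "complex set" where
  "Tcirc \<equiv> sphere 0 1"

text \<open>Closed / open positively oriented arcs given by real lifts a \<le> c (with c - a \<le> 1).\<close>
definition carc :: "real \<Rightarrow> real \<Rightarrow> complex set" where
  "carc a c = circ ` {a..c}"

definition oarc :: "real \<Rightarrow> real \<Rightarrow> complex set" where
  "oarc a c = circ ` {a<..<c}"

text \<open>1-periodic extension of the upper boundary b (given on [-1/2,1/2]); the vertical sides
  x = -1/2 and x = 1/2 of the unfolded table are identified, the upper boundary point (x, b x)
  is identified with the lower one (x, - b x).\<close>
definition per_ext :: "(real \<Rightarrow> real) \<Rightarrow> real \<Rightarrow> real" where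
  "per_ext b x = b (x - of_int \<lfloor>x + 1/2\<rfloor>)"

text \<open>Time after which the flow line of direction theta started at (x,0) on Sigma first reaches
  the upper boundary.\<close>
definition hit_time :: "(real \<Rightarrow> real) \<Rightarrow> real \<Rightarrow> real \<Rightarrow> real" where
  "hit_time b \<theta> x = Inf {t. 0 \<le> t \<and> per_ext b (x + t * cos \<theta>) \<le> t * sin \<theta>}"

text \<open>Lift F of the first-return map to Sigma: leave the upper boundary at abscissa X,
  re-enter at (X, - b X) and flow up to height 0.\<close>
definition wave_lift :: "(real \<Rightarrow> real) \<Rightarrow> real \<Rightarrow> real \<Rightarrow> real" where
  "wave_lift b \<theta> x =
     (let X = x + hit_time b \<theta> x * cos \<theta> in X + per_ext b X * cos \<theta> / sin \<theta>)"

definition wave_map :: "(real \<Rightarrow> real) \<Rightarrow> real \<Rightarrow> complex \<Rightarrow> complex" where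
  "wave_map b \<theta> z = circ (wave_lift b \<theta> (Arg z / (2 * pi)))"

definition rot_num :: "(real \<Rightarrow> real) \<Rightarrow> real" where
  "rot_num F = frac (lim (\<lambda>n. ((F ^^ n) 0 - 0) / real n))"

definition strictly_concave_on :: "real set \<Rightarrow> (real \<Rightarrow> real) \<Rightarrow> bool" where
  "strictly_concave_on S g \<longleftrightarrow>
     (\<forall>x\<in>S. \<forall>y\<in>S. \<forall>t. x \<noteq> y \<and> 0 < t \<and> t < 1 \<longrightarrow>
        g (t * x + (1 - t) * y) > t * g x + (1 - t) * g y)"

definition full_orbit :: "(complex \<Rightarrow> complex) \<Rightarrow> complex \<Rightarrow> complex set" where
  "full_orbit f z = {(f ^^ n) z | n. True} \<union> {((inv_into Tcirc f) ^^ n) z | n. True}"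

text \<open>Successor of index i in Z_q on the lifted cyclic chain: for i = q-1 wrap around (+1).\<close>
definition nxt :: "nat \<Rightarrow> (nat \<Rightarrow> real) \<Rightarrow> nat \<Rightarrow> real" where
  "nxt q x i = (if i + 1 < q then x (i + 1) else x 0 + 1)"

definition periodic_structure ::
  "(complex \<Rightarrow> complex) \<Rightarrow> nat \<Rightarrow> nat \<Rightarrow> (nat \<Rightarrow> complex set) \<Rightarrow> (nat \<Rightarrow> complex set) \<Rightarrow> bool" where
  "periodic_structure f p q Pp Pm \<longleftrightarrow>
     (\<forall>i<q. \<forall>z \<in> Pp i \<union> Pm i. (f ^^ q) z = z) \<and>
     (\<forall>i<q. \<forall>n. (f ^^ n) ` Pp i = Pp ((i + p * n) mod q) \<and>
                (f ^^ n) ` Pm i = Pm ((i + p * n) mod q)) \<and>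
     (\<forall>z \<in> Tcirc - ((\<Union>i<q. Pp i) \<union> (\<Union>i<q. Pm i)). \<forall>n>0. (f ^^ n) z \<noteq> z)"

definition gap_dynamics ::
  "(complex \<Rightarrow> complex) \<Rightarrow> nat \<Rightarrow> nat \<Rightarrow> (nat \<Rightarrow> real) \<Rightarrow> (nat \<Rightarrow> real) \<Rightarrow>
   (nat \<Rightarrow> real) \<Rightarrow> (nat \<Rightarrow> real) \<Rightarrow> bool" where
  "gap_dynamics f p q lo hi att rep \<longleftrightarrow>
     (\<forall>i<q. \<forall>z \<in> oarc (lo i) (hi i).
        (\<forall>n. (f ^^ n) z \<in> oarc (lo ((i + p * n) mod q)) (hi ((i + p * n) mod q))) \<and>
        ((\<lambda>n. (f ^^ (n * q)) z) \<longlonglongrightarrow> circ (att i)) \<and>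
        ((\<lambda>n. ((inv_into Tcirc f) ^^ (n * q)) z) \<longlonglongrightarrow> circ (rep i)))"

definition case_a :: "(complex \<Rightarrow> complex) \<Rightarrow> nat \<Rightarrow> nat \<Rightarrow> bool" where
  "case_a f p q \<longleftrightarrow>
     (\<exists>xm xp :: nat \<Rightarrow> real.
        (\<forall>i<q. xm i \<le> xp i \<and> xp i \<le> nxt q xm i) \<and>
        periodic_structure f p q (\<lambda>i. {circ (xp i)}) (\<lambda>i. {circ (xm i)}) \<and>
        gap_dynamics f p q xm xp xp xm \<and>
        gap_dynamics f p q xp (nxt q xm) xp (nxt q xm))"

definition case_b :: "(complex \<Rightarrow> complex) \<Rightarrow> nat \<Rightarrow> nat \<Rightarrow> bool" where
  "case_b f p q \<longleftrightarrow>
     (\<exists>xL xR :: nat \<Rightarrow> real.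
        (\<forall>i<q. xL i < xR i \<and> xR i \<le> nxt q xL i) \<and>
        periodic_structure f p q (\<lambda>i. carc (xL i) (xR i)) (\<lambda>i. carc (xL i) (xR i)) \<and>
        ((\<forall>i<q. xR i < nxt q xL i) \<or> (\<forall>i<q. xR i = nxt q xL i)) \<and>
        ((\<forall>i<q. xR i < nxt q xL i) \<longrightarrow> gap_dynamics f p q xR (nxt q xL) xR (nxt q xL)) \<and>
        ((\<forall>i<q. xR i = nxt q xL i) \<longrightarrow> (\<forall>z\<in>Tcirc. \<exists>n>0. (f ^^ n) z = z)))"

end

theory Submission
  imports Defs
begin

text \<open>
  Let \<open>X\<close> be the abscissa at which a flow line crosses the upper boundary. The return map sends
  \<open>X - b X cot \<theta>\<close> to \<open>X + b X cot \<theta>\<close>. On a period of \<open>b\<close> the former is a convex and the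
  latter a concave function of \<open>X\<close>, and both are increasing because the slope of \<open>b\<close> is below
  \<open>tan \<theta>\<close>. Hence the lift \<open>F\<close> is increasing, bi-Lipschitz and concave on \<open>[a, a + 1]\<close>, with a
  single upward break of slope, modulo 1, at \<open>a\<close>.

  If the translation number \<open>\<tau>\<close> is irrational, \<open>h x = sup\<^sub>k (F\<^sup>k x - k \<tau>)\<close> is a monotone
  semiconjugacy to the rotation. An interval on which \<open>h\<close> is constant has pairwise disjoint iterates
  modulo 1, whose lengths therefore tend to 0. Concavity bounds the variation of the logarithmic
  slopes along closest returns, so Denjoy's argument contradicts this.

  If \<open>\<tau> = P/q\<close>, the periodic points are the zeros of \<open>F\<^sup>q x - x - P\<close>, a function that is concave
  between break points. If \<open>a\<close> is not periodic, the function is negative at every break point: it has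
  the same sign at all of them, and by concavity a zero between two break points excludes the positive
  sign. Since the orbit of the gap \<open>(l, u)\<close> of periodic points around \<open>a\<close> contains all the break
  points, there is none between \<open>u\<close> and the next translate of \<open>l\<close>, and by concavity the zeros there
  are the two end points or the whole interval.
\<close>

section \<open>Real functions and Diophantine approximation\<close>

lemma concave_on_slope_antimono:
  fixes f :: "real \<Rightarrow> real"
  assumes conc: "concave_on I f" and "u \<in> I" "z \<in> I"
    and "u < v" "w < z" "u \<le> w" "v \<le> z"
  shows "(f z - f w) / (z - w) \<le> (f v - f u) / (v - u)"
proof -
  define slope where "slope x y = (f y - f x) / (y - x)" for x y
  have slope_uminus: "(- f x - - f y) / (x - y) = - slope x y" for x y
    unfolding slope_def by (metis minus_diff_eq minus_diff_minus minus_divide_right)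
  note chord = convex_on_slope_le[OF conc[unfolded concave_on_def] \<open>u \<in> I\<close> \<open>z \<in> I\<close>, unfolded slope_uminus]
  have "slope w z \<le> slope u z"
    using chord(2)[of w] assms by (cases "u = w") auto
  also have "slope u z \<le> slope u v"
    using chord(1)[of v] assms by (cases "v = z") auto
  finally show ?thesis by (simp add: slope_def)
qed

lemma concave_on_le_left_tangent:
  fixes f :: "real \<Rightarrow> real"
  assumes conc: "concave_on {l..r} f"
    and deriv: "(f has_real_derivative D) (at l within {l..r})"
    and "l \<le> s" "s < t" "t \<le> r"
  shows "f t - f s \<le> D * (t - s)"
proof -
  let ?F = "at l within {l..r}"
  have "((\<lambda>w. (f w - f l) / (w - l)) \<longlongrightarrow> D) ?F"
    using deriv by (simp add: has_field_derivative_iff)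
  moreover have "\<forall>\<^sub>F w in ?F. (f t - f s) / (t - s) \<le> (f w - f l) / (w - l)"
    unfolding eventually_at
  proof (intro exI[of _ "t - l"] conjI ballI impI)
    fix w assume "w \<in> {l..r}" "w \<noteq> l \<and> dist w l < t - l"
    then show "(f t - f s) / (t - s) \<le> (f w - f l) / (w - l)"
      by (intro concave_on_slope_antimono[OF conc]) (use assms in \<open>auto simp: dist_real_def\<close>)
  qed (use assms in simp)
  moreover have "?F \<noteq> bot"
    using assms by (simp add: trivial_limit_within islimpt_Icc)
  ultimately have "(f t - f s) / (t - s) \<le> D" by (intro tendsto_lowerbound)
  then show ?thesis using \<open>s < t\<close> by (simp add: divide_le_eq)
qed

lemma concave_on_pos_open_segment:
  assumes "concave_on S f" "x \<in> S" "y \<in> S" "0 \<le> f x" "0 < f y" "w \<in> open_segment x y"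
  shows "0 < f w"
proof -
  obtain t where t: "0 < t" "t < 1" "w = (1 - t) *\<^sub>R x + t *\<^sub>R y"
    using assms(6) by (auto simp: in_segment)
  have "0 < (1 - t) * f x + t * f y"
    using t assms(4,5) by (simp add: add_nonneg_pos)
  also have "\<dots> \<le> f w"
    unfolding t(3) using t assms(1-3) by (intro concave_onD) auto
  finally show ?thesis .
qed

lemma concave_on_translate: "concave_on {c..d::real} (\<lambda>x. x - e)"
  by (intro concave_on_diff) (simp_all add: concave_on_ident convex_on_const)

lemma concave_on_compose:
  fixes f :: "real \<Rightarrow> real"
  assumes f: "concave_on J f" "mono f" and g: "concave_on I g" "g ` I \<subseteq> J"
  shows "concave_on I (f \<circ> g)"
  unfolding concave_on_iff
proof (intro conjI ballI allI impI)
  show "convex I" using g(1) by (rule concave_on_imp_convex)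
  fix x y and u v :: real
  assume xy: "x \<in> I" "y \<in> I" and uv: "0 \<le> u" "0 \<le> v" "u + v = 1"
  have "u * f (g x) + v * f (g y) \<le> f (u * g x + v * g y)"
    using f(1) g(2) xy uv unfolding concave_on_iff by (simp add: image_subset_iff)
  also have "\<dots> \<le> f (g (u *\<^sub>R x + v *\<^sub>R y))"
    using g(1) xy uv unfolding concave_on_iff by (intro monoD[OF f(2)]) blast
  finally show "u * (f \<circ> g) x + v * (f \<circ> g) y \<le> (f \<circ> g) (u *\<^sub>R x + v *\<^sub>R y)" by simp
qed

lemma concave_on_cong:
  assumes "concave_on S g" "\<And>x. x \<in> S \<Longrightarrow> f x = g x"
  shows "concave_on S f"
  unfolding concave_on_iff
proof (intro conjI ballI allI impI)
  show conv: "convex S" using assms(1) by (rule concave_on_imp_convex)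
  fix x y and u v :: real
  assume xy: "x \<in> S" "y \<in> S" and uv: "0 \<le> u" "0 \<le> v" "u + v = 1"
  then have "u * g x + v * g y \<le> g (u *\<^sub>R x + v *\<^sub>R y)"
    using assms(1) unfolding concave_on_iff by blast
  then show "u * f x + v * f y \<le> f (u *\<^sub>R x + v *\<^sub>R y)"
    using assms(2) xy convexD[OF conv xy uv] by simp
qed

lemma strictly_concave_onD:
  assumes "strictly_concave_on S g" "x \<in> S" "y \<in> S" "x \<noteq> y" "0 < t" "t < 1"
  shows "t * g x + (1 - t) * g y < g (t * x + (1 - t) * y)"
  using assms unfolding strictly_concave_on_def by blast

lemma strictly_concave_on_compose:
  assumes f: "strictly_concave_on J f" "mono f"
    and g: "concave_on I g" "g ` I \<subseteq> J" "inj_on g I"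
  shows "strictly_concave_on I (f \<circ> g)"
  unfolding strictly_concave_on_def
proof (intro ballI allI impI)
  fix x y t :: real
  assume xy: "x \<in> I" "y \<in> I" and t: "x \<noteq> y \<and> 0 < t \<and> t < 1"
  have "t * f (g x) + (1 - t) * f (g y) < f (t * g x + (1 - t) * g y)"
    using f(1) g(2,3) xy t by (intro strictly_concave_onD) (auto dest: inj_onD)
  also have "\<dots> \<le> f (g (t * x + (1 - t) * y))"
    using concave_onD[OF g(1), of "1 - t" x y] xy t by (intro monoD[OF f(2)]) auto
  finally show "t * (f \<circ> g) x + (1 - t) * (f \<circ> g) y < (f \<circ> g) (t * x + (1 - t) * y)" by simp
qed

lemma concave_on_inverse:
  fixes f g :: "real \<Rightarrow> real"
  assumes f: "convex_on I f" "strict_mono f" and f_g: "\<And>y. f (g y) = y"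
    and g: "convex J" "g ` J \<subseteq> I"
  shows "concave_on J g"
  unfolding concave_on_iff
proof (intro conjI ballI allI impI)
  fix x y and u v :: real
  assume xy: "x \<in> J" "y \<in> J" and uv: "0 \<le> u" "0 \<le> v" "u + v = 1"
  have "f (u *\<^sub>R g x + v *\<^sub>R g y) \<le> u * f (g x) + v * f (g y)"
    using f(1) g(2) xy uv unfolding convex_on_def by (simp add: image_subset_iff)
  also have "\<dots> = f (g (u *\<^sub>R x + v *\<^sub>R y))" by (simp add: f_g)
  finally show "u * g x + v * g y \<le> g (u *\<^sub>R x + v *\<^sub>R y)"
    using f(2) by (simp add: strict_mono_less_eq)
qed (rule g(1))

lemma sum_nonoverlapping_le:
  fixes lo hi :: "'i \<Rightarrow> real"
  assumes "finite I" "c \<le> d"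
    and bounds: "\<And>i. i \<in> I \<Longrightarrow> c \<le> lo i \<and> lo i \<le> hi i \<and> hi i \<le> d"
    and nonoverlapping: "\<And>i j. i \<in> I \<Longrightarrow> j \<in> I \<Longrightarrow> i \<noteq> j \<Longrightarrow> hi i \<le> lo j \<or> hi j \<le> lo i"
  shows "(\<Sum>i\<in>I. hi i - lo i) \<le> d - c"
proof -
  have disj: "disjoint_family_on (\<lambda>i. {lo i<..<hi i}) I"
    unfolding disjoint_family_on_def using nonoverlapping by fastforce
  have "(\<Sum>i\<in>I. hi i - lo i) = (\<Sum>i\<in>I. measure lborel {lo i<..<hi i})"
    using bounds by (intro sum.cong) auto
  also have "\<dots> = measure lborel (\<Union>i\<in>I. {lo i<..<hi i})"
    by (rule measure_finite_Union[symmetric, OF \<open>finite I\<close> _ disj]) (use bounds in auto)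
  also have "\<dots> \<le> measure lborel {c..d}"
  proof (rule measure_mono_fmeasurable)
    show "(\<Union>i\<in>I. {lo i<..<hi i}) \<subseteq> {c..d}" using bounds by fastforce
  qed (use \<open>finite I\<close> fmeasurable_compact in auto)
  finally show ?thesis using \<open>c \<le> d\<close> by simp
qed

lemma iterate_LIMSEQ_right:
  fixes G :: "real \<Rightarrow> real" and t :: "nat \<Rightarrow> real"
  assumes cont: "continuous_on UNIV G" and t_0: "t 0 \<in> {y<..<y'}"
    and t_Suc: "\<And>n. t (Suc n) = G (t n)"
    and G: "\<And>x. x \<in> {y<..<y'} \<Longrightarrow> x < G x \<and> G x < y'"
  shows "t \<longlonglongrightarrow> y'"
proof -
  have mem: "t n \<in> {y<..<y'}" for n
    by (induction n) (use t_0 t_Suc G in force)+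
  have "incseq t" using mem G t_Suc by (intro incseq_SucI) (metis less_imp_le)
  then obtain L where L: "t \<longlonglongrightarrow> L" "\<And>n. t n \<le> L"
    using incseq_convergent[of t y'] mem by (metis greaterThanLessThan_iff less_imp_le)
  have "(\<lambda>n. G (t n)) \<longlonglongrightarrow> G L"
    by (rule continuous_on_tendsto_compose[OF cont L(1)]) auto
  then have "G L = L" using LIMSEQ_Suc[OF L(1)] LIMSEQ_unique by (simp add: t_Suc)
  moreover have "L \<le> y'" using L(1) mem by (intro LIMSEQ_le_const2[of t]) (auto intro: less_imp_le)
  moreover have "y < L" using mem[of 0] L(2)[of 0] by simp
  ultimately have "L = y'" using G[of L] by fastforce
  then show ?thesis using L(1) by simp
qed

lemma iterate_LIMSEQ_left:
  fixes G :: "real \<Rightarrow> real" and t :: "nat \<Rightarrow> real"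
  assumes cont: "continuous_on UNIV G" and t_0: "t 0 \<in> {y<..<y'}"
    and t_Suc: "\<And>n. t (Suc n) = G (t n)"
    and G: "\<And>x. x \<in> {y<..<y'} \<Longrightarrow> y < G x \<and> G x < x"
  shows "t \<longlonglongrightarrow> y"
proof -
  have "(\<lambda>n. - t n) \<longlonglongrightarrow> - y"
  proof (rule iterate_LIMSEQ_right[where G = "\<lambda>x. - G (- x)" and y = "- y'"])
    show "continuous_on UNIV (\<lambda>x. - G (- x))"
      by (intro continuous_intros continuous_on_compose2[OF cont]) auto
    show "x < - G (- x) \<and> - G (- x) < - y" if "x \<in> {- y'<..<- y}" for x
      using G[of "- x"] that by auto
  qed (use t_0 t_Suc in auto)
  then show ?thesis using tendsto_minus_cancel by blast
qed

lemma mono_dense_range_imp_continuous_on: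
  fixes h :: "real \<Rightarrow> real"
  assumes "mono h" and dense: "\<And>y z. y < z \<Longrightarrow> \<exists>w. y < h w \<and> h w < z"
  shows "continuous_on UNIV h"
proof (rule continuous_onI)
  fix x e :: real assume "0 < e"
  obtain u where u: "h x - e < h u" "h u < h x" using dense[of "h x - e" "h x"] \<open>0 < e\<close> by auto
  obtain v where v: "h x < h v" "h v < h x + e" using dense[of "h x" "h x + e"] \<open>0 < e\<close> by auto
  have "u < x" "x < v" using u v \<open>mono h\<close> by (meson linorder_not_less monoD)+
  show "\<exists>d>0. \<forall>x'\<in>UNIV. dist x' x < d \<longrightarrow> dist (h x') (h x) \<le> e"
  proof (intro exI[of _ "min (v - x) (x - u)"] conjI ballI impI)
    fix y assume "dist y x < min (v - x) (x - u)"
    then have "u \<le> y" "y \<le> v" by (auto simp: dist_real_def)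
    then have "h u \<le> h y" "h y \<le> h v" using \<open>mono h\<close> by (auto dest: monoD)
    then show "dist (h y) (h x) \<le> e" using u v by (auto simp: dist_real_def)
  qed (use \<open>u < x\<close> \<open>x < v\<close> in auto)
qed

lemma expanding_imp_strict_mono:
  fixes g :: "real \<Rightarrow> real"
  assumes "0 < c" "\<And>x y. x \<le> y \<Longrightarrow> c * (y - x) \<le> g y - g x"
  shows "strict_mono g"
proof
  fix x y :: real assume "x < y"
  then have "0 < c * (y - x)" using \<open>0 < c\<close> by simp
  then show "g x < g y" using assms(2)[of x y] \<open>x < y\<close> by simp
qed

lemma expanding_imp_surj:
  fixes g :: "real \<Rightarrow> real"
  assumes "0 < c" "\<And>x y. x \<le> y \<Longrightarrow> c * (y - x) \<le> g y - g x" "continuous_on UNIV g"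
  shows "surj g"
proof -
  have "y \<in> range g" for y
  proof -
    define R where "R = \<bar>y - g 0\<bar> / c"
    have R: "0 \<le> R" "c * R = \<bar>y - g 0\<bar>" using \<open>0 < c\<close> by (simp_all add: R_def)
    have "g (- R) \<le> y" "y \<le> g R" using assms(2)[of "- R" 0] assms(2)[of 0 R] R by auto
    then show ?thesis
      using IVT'[of g "- R" y R] R(1) continuous_on_subset[OF assms(3)] by auto
  qed
  then show ?thesis by blast
qed

lemma closed_gap:
  fixes S :: "real set"
  assumes "closed S" "x \<notin> S" "y \<in> S" "y \<le> x" "z \<in> S" "x \<le> z"
  obtains l u where "l \<in> S" "u \<in> S" "l < x" "x < u" "{l<..<u} \<inter> S = {}"
proof -
  define l u where "l = Sup (S \<inter> {..x})" and "u = Inf (S \<inter> {x..})"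
  have bdd: "bdd_above (S \<inter> {..x})" "bdd_below (S \<inter> {x..})" by auto
  have "l \<in> S \<inter> {..x}"
    unfolding l_def using assms by (intro closed_contains_Sup bdd(1) closed_Int closed_atMost) auto
  then have l: "l \<in> S" "l < x" using \<open>x \<notin> S\<close> by (auto simp: order.order_iff_strict)
  have "u \<in> S \<inter> {x..}"
    unfolding u_def using assms by (intro closed_contains_Inf bdd(2) closed_Int closed_atLeast) auto
  then have u: "u \<in> S" "x < u" using \<open>x \<notin> S\<close> by (auto simp: order.order_iff_strict)
  have "w \<le> l \<or> u \<le> w" if "w \<in> S" for w
    using cSup_upper[OF _ bdd(1), of w] cInf_lower[OF _ bdd(2), of w] that
    unfolding l_def u_def by (cases "w \<le> x") auto
  then have "{l<..<u} \<inter> S = {}" by fastforce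
  then show ?thesis using that l u by blast
qed

lemma irrational_int_combination_eq_0_iff:
  fixes \<tau> :: real
  assumes "\<tau> \<notin> \<rat>"
  shows "of_int k * \<tau> + of_int m = 0 \<longleftrightarrow> k = 0 \<and> m = 0"
proof
  assume zero: "of_int k * \<tau> + of_int m = 0"
  have "k = 0"
  proof (rule ccontr)
    assume "k \<noteq> 0"
    then have "\<tau> = of_int (- m) / of_int k" using zero by (simp add: field_simps)
    then show False using assms by (metis Rats_divide Rats_of_int)
  qed
  then show "k = 0 \<and> m = 0" using zero by simp
qed simp

definition dist_Ints :: "real \<Rightarrow> real" where
  "dist_Ints x = \<bar>x - of_int (round x)\<bar>"

lemma dist_Ints_le: "dist_Ints x \<le> \<bar>x - of_int m\<bar>"
  unfolding dist_Ints_def by (rule round_diff_minimal)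

lemma dist_Ints_le_half: "dist_Ints x \<le> 1/2"
  using of_int_round_abs_le[of x] by (simp add: dist_Ints_def abs_minus_commute)

lemma dist_Ints_diff_le: "\<bar>dist_Ints x - dist_Ints y\<bar> \<le> \<bar>x - y\<bar>"
proof -
  have "dist_Ints x \<le> dist_Ints y + \<bar>x - y\<bar>" for x y
    using dist_Ints_le[of x "round y"] unfolding dist_Ints_def by linarith
  from this[of x y] this[of y x] show ?thesis by linarith
qed

lemma dist_Ints_irrational_multiple_pos:
  assumes "\<tau> \<notin> \<rat>" "0 < j"
  shows "0 < dist_Ints (real j * \<tau>)"
  using irrational_int_combination_eq_0_iff[OF assms(1), of "int j" "- round (real j * \<tau>)"] assms(2)
  by (simp add: dist_Ints_def)

definition closest_return :: "real \<Rightarrow> nat \<Rightarrow> int \<Rightarrow> bool" where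
  "closest_return \<tau> q n \<longleftrightarrow>
    (\<forall>j m. 0 < j \<and> j < q \<longrightarrow> \<bar>real q * \<tau> - of_int n\<bar> < \<bar>real j * \<tau> - of_int m\<bar>)"

lemma closest_return_less:
  assumes "closest_return \<tau> q n" "k < q" "l < q" "k \<noteq> l"
  shows "\<bar>real q * \<tau> - of_int n\<bar> < \<bar>(real k - real l) * \<tau> + of_int m\<bar>"
proof (cases "l < k")
  case True
  then show ?thesis
    using assms(1)[unfolded closest_return_def, rule_format, of "k - l" "- m"] assms(2)
    by (simp add: of_nat_diff)
next
  case False
  then have "\<bar>real q * \<tau> - of_int n\<bar> < \<bar>- ((real k - real l) * \<tau> + of_int m)\<bar>"
    using assms(1)[unfolded closest_return_def, rule_format, of "l - k" m] assms(3,4)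
    by (simp add: of_nat_diff algebra_simps)
  then show ?thesis by simp
qed

lemma closest_return_exists:
  fixes \<tau> :: real
  assumes "\<tau> \<notin> \<rat>"
  obtains q n where "N < q" "closest_return \<tau> q n"
proof -
  define \<delta> where "\<delta> j = dist_Ints (real j * \<tau>)" for j
  define \<mu> where "\<mu> = Min (\<delta> ` {1..Suc N})"
  have "0 < \<mu>"
    unfolding \<mu>_def using dist_Ints_irrational_multiple_pos[OF assms] by (subst Min_gr_iff) (auto simp: \<delta>_def)
  then obtain k where "0 < k" "\<bar>frac (real k * \<tau>) - 0\<bar> < \<mu>"
    using Kronecker_approx_1_explicit[OF assms, of 0 \<mu>] by auto
  then have "0 < k \<and> \<delta> k < \<mu>"
    using dist_Ints_le[of "real k * \<tau>" "\<lfloor>real k * \<tau>\<rfloor>"] by (simp add: frac_def \<delta>_def)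
  then obtain q where q: "0 < q" "\<delta> q < \<mu>"
    and least: "\<And>j. j < q \<Longrightarrow> \<not> (0 < j \<and> \<delta> j < \<mu>)"
    using exists_least_iff[of "\<lambda>k. 0 < k \<and> \<delta> k < \<mu>"] by blast
  have "N < q"
  proof (rule ccontr)
    assume "\<not> N < q"
    then have "\<mu> \<le> \<delta> q" unfolding \<mu>_def using q(1) by (intro Min_le) auto
    then show False using q(2) by simp
  qed
  moreover have "\<delta> q < \<bar>real j * \<tau> - of_int m\<bar>" if "0 < j" "j < q" for j m
    using q(2) least[OF that(2)] that(1) dist_Ints_le[of "real j * \<tau>" m] by (simp add: \<delta>_def)
  then have "closest_return \<tau> q (round (real q * \<tau>))"
    unfolding closest_return_def \<delta>_def dist_Ints_def by blast
  ultimately show ?thesis by (rule that)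
qed

section \<open>Lifts of circle homeomorphisms\<close>

lemma circ_eq_iff: "circ x = circ y \<longleftrightarrow> (\<exists>m::int. x = y + of_int m)"
proof -
  have "circ x = circ y \<longleftrightarrow> (\<exists>n::int. 2 * pi * x = 2 * pi * y + 2 * pi * of_int n)"
    using sin_cos_eq_iff[of "2 * pi * x" "2 * pi * y"] by (auto simp: circ_def complex_eq_iff)
  also have "\<dots> \<longleftrightarrow> (\<exists>n::int. 2 * pi * x = 2 * pi * (y + of_int n))"
    by (simp only: distrib_left)
  finally show ?thesis by simp
qed

lemma circ_shift [simp]: "circ (x + of_int m) = circ x"
  by (auto simp: circ_eq_iff)

lemma circ_add: "circ (x + y) = circ x * circ y"
  by (simp add: circ_def cis_mult ring_distribs)

lemma norm_circ [simp]: "cmod (circ x) = 1"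
  by (simp add: circ_def)

lemma circ_Arg: "z \<in> Tcirc \<Longrightarrow> circ (Arg z / (2 * pi)) = z"
  by (cases "z = 0") (auto simp: circ_def cis_Arg sgn_eq)

lemma Arg_circ: obtains m :: int where "Arg (circ x) / (2 * pi) = x + of_int m"
  using circ_Arg[of "circ x"] by (auto simp: circ_eq_iff)

lemma Tcirc_cases:
  assumes "z \<in> Tcirc" obtains x where "z = circ x"
  using assms by (metis circ_Arg)

lemma continuous_on_circ: "continuous_on A circ"
  unfolding circ_def by (intro continuous_intros)

lemma tendsto_circ: "(g \<longlongrightarrow> l) G \<Longrightarrow> ((\<lambda>x. circ (g x)) \<longlongrightarrow> circ l) G"
  by (rule continuous_on_tendsto_compose[OF continuous_on_circ[of UNIV]]) auto

lemma circ_image_unit_interval: "circ ` {0..1} = Tcirc"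
proof (intro equalityI subsetI)
  fix z assume "z \<in> Tcirc"
  then obtain x where "z = circ x" by (rule Tcirc_cases)
  then have "z = circ (frac x)" by (auto simp: circ_eq_iff frac_def intro: exI[of _ "\<lfloor>x\<rfloor>"])
  moreover have "frac x \<in> {0..1}" using frac_lt_1[of x] by (simp add: less_imp_le)
  ultimately show "z \<in> circ ` {0..1}" by blast
qed auto

lemma continuous_on_Tcirc_iff: "continuous_on Tcirc H \<longleftrightarrow> continuous_on {0..1} (H \<circ> circ)"
proof -
  have "quotient_map (top_of_set {0..1}) (top_of_set Tcirc) circ"
  proof (rule T1_Spaces.continuous_imp_quotient_map)
    show "continuous_map (top_of_set {0..1}) (top_of_set Tcirc) circ"
      by (auto simp: continuous_on_circ)
  qed (simp_all add: circ_image_unit_interval compact_space_subtopology Hausdorff_space_subtopology)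
  from continuous_compose_quotient_map_eq[OF this, of euclidean H] show ?thesis by simp
qed

locale circle_lift =
  fixes F :: "real \<Rightarrow> real"
  assumes F_strict_mono: "strict_mono F"
    and F_surj: "surj F"
    and F_shift: "F (x + 1) = F x + 1"
begin

lemma F_inv [simp]: "F (inv F x) = x"
  using F_surj by (simp add: surj_f_inv_f)

lemma inv_F [simp]: "inv F (F x) = x"
  using F_strict_mono by (simp add: strict_mono_imp_inj_on)

lemma F_less_iff [simp]: "F x < F y \<longleftrightarrow> x < y"
  using F_strict_mono by (simp add: strict_mono_less)

lemma inv_F_less_iff [simp]: "inv F x < inv F y \<longleftrightarrow> x < y"
  by (metis F_inv F_less_iff)

lemma F_shift_int: "F (x + of_int m) = F x + of_int m"
proof (induction m rule: int_induct[where k = 0])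
  case base then show ?case by simp
next
  case (step1 i)
  then show ?case using F_shift[of "x + of_int i"] by (simp add: algebra_simps)
next
  case (step2 i)
  then show ?case using F_shift[of "x + of_int i - 1"] by (simp add: algebra_simps)
qed

lemma inv_F_shift_int: "inv F (x + of_int m) = inv F x + of_int m"
  by (metis F_inv F_shift_int inv_F)

definition iter :: "int \<Rightarrow> real \<Rightarrow> real" where
  "iter k = (if 0 \<le> k then F ^^ nat k else inv F ^^ nat (- k))"

lemma iter_0 [simp]: "iter 0 x = x"
  by (simp add: iter_def)

lemma iter_nat: "iter (int n) x = (F ^^ n) x"
  by (simp add: iter_def)

lemma iter_neg_nat: "iter (- int n) x = (inv F ^^ n) x"
  by (simp add: iter_def)

lemma iter_Suc: "iter (k + 1) x = F (iter k x)"
proof (cases "0 \<le> k")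
  case True
  then show ?thesis by (simp add: iter_def nat_add_distrib)
next
  case False
  then obtain n where n: "k = - int (Suc n)"
    by (metis int_cases linorder_not_less of_nat_0_le_iff)
  then have "iter k x = inv F ((inv F ^^ n) x)" by (simp only: iter_neg_nat) simp
  moreover have "k + 1 = - int n" using n by simp
  ultimately show ?thesis by (simp only: iter_neg_nat F_inv)
qed

lemma iter_pred: "iter (k - 1) x = inv F (iter k x)"
  using iter_Suc[of "k - 1" x] by simp

lemma iter_1 [simp]: "iter 1 = F"
  using iter_Suc[of 0] by auto

lemma iter_add: "iter (j + k) x = iter j (iter k x)"
proof (induction j rule: int_induct[where k = 0])
  case base then show ?case by simp
next
  case (step1 i)
  then show ?case using iter_Suc[of "i + k" x] iter_Suc[of i "iter k x"] by (simp add: ac_simps)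
next
  case (step2 i)
  then show ?case using iter_pred[of "i + k" x] iter_pred[of i "iter k x"]
    by (simp add: algebra_simps)
qed

lemma iter_less_iff [simp]: "iter k x < iter k y \<longleftrightarrow> x < y"
proof -
  have "(F ^^ n) x < (F ^^ n) y \<longleftrightarrow> x < y" "(inv F ^^ n) x < (inv F ^^ n) y \<longleftrightarrow> x < y" for n
    by (induction n) auto
  then show ?thesis by (simp add: iter_def)
qed

lemma iter_le_iff [simp]: "iter k x \<le> iter k y \<longleftrightarrow> x \<le> y"
  by (meson iter_less_iff linorder_not_less)

lemma iter_eq_iff [simp]: "iter k x = iter k y \<longleftrightarrow> x = y"
  by (simp add: order.eq_iff)

lemma iter_shift: "iter k (x + of_int m) = iter k x + of_int m"
proof (induction k rule: int_induct[where k = 0])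
  case base then show ?case by simp
next
  case (step1 i) then show ?case by (simp add: iter_Suc F_shift_int)
next
  case (step2 i) then show ?case by (simp add: iter_pred inv_F_shift_int)
qed

text \<open>The action on the line of the group \<open>\<int>\<^sup>2\<close> of all lifts of iterates of the circle map.\<close>

definition act :: "int \<Rightarrow> int \<Rightarrow> real \<Rightarrow> real" where
  "act k m x = iter k x + of_int m"

lemma act_0 [simp]: "act 0 0 x = x"
  by (simp add: act_def)

lemma act_add: "act (k + k') (m + m') x = act k m (act k' m' x)"
  by (simp add: act_def iter_add iter_shift)

lemma act_uminus [simp]: "act k m (act (- k) (- m) x) = x" "act (- k) (- m) (act k m x) = x"
  using act_add[of k "- k" m "- m" x] act_add[of "- k" k "- m" m x] by auto

lemma act_commute: "act k m (act k' m' x) = act k' m' (act k m x)"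
  by (simp add: add.commute flip: act_add)

lemma act_less_iff [simp]: "act k m x < act k m y \<longleftrightarrow> x < y"
  by (simp add: act_def)

lemma act_le_iff [simp]: "act k m x \<le> act k m y \<longleftrightarrow> x \<le> y"
  by (simp add: act_def)

lemma act_eq_iff [simp]: "act k m x = act k m y \<longleftrightarrow> x = y"
  by (simp add: order.eq_iff)

lemma continuous_on_act: "continuous_on A (act k m)"
proof -
  have "surj (act k m)" by (metis act_uminus(1) surjI)
  then have "continuous_on UNIV (act k m)" by (intro continuous_onI_mono) auto
  then show ?thesis using continuous_on_subset by blast
qed

lemma iter_displacement: "\<bar>(iter k x - x) - (iter k y - y)\<bar> \<le> 1"
proof -
  define m where "m = - \<lfloor>y - x\<rfloor>"
  have m: "x \<le> y + of_int m" "y + of_int m < x + of_int 1" unfolding m_def by linarith+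
  then have "iter k x \<le> iter k (y + of_int m)" "iter k (y + of_int m) < iter k (x + of_int 1)"
    by (simp_all only: iter_le_iff iter_less_iff)
  then show ?thesis using m unfolding iter_shift by simp
qed

definition trans_num :: real where
  "trans_num = lim (\<lambda>n. (F ^^ n) 0 / real n)"

lemma funpow_quasi_linear: "\<bar>(F ^^ (m * n)) 0 - real m * (F ^^ n) 0\<bar> \<le> real m"
proof (induction m)
  case 0 then show ?case by simp
next
  case (Suc m)
  have "(F ^^ (Suc m * n)) 0 = (F ^^ n) ((F ^^ (m * n)) 0)" by (simp add: funpow_add)
  moreover have "\<bar>((F ^^ n) ((F ^^ (m * n)) 0) - (F ^^ (m * n)) 0) - ((F ^^ n) 0 - 0)\<bar> \<le> 1"
    using iter_displacement[of "int n"] by (simp only: iter_nat)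
  ultimately show ?case using Suc.IH by (simp add: algebra_simps abs_le_iff)
qed

lemma funpow_average_diff_le:
  assumes "0 < m" "0 < n"
  shows "\<bar>(F ^^ m) 0 / real m - (F ^^ n) 0 / real n\<bar> \<le> 1 / real m + 1 / real n"
proof -
  have "\<bar>real n * (F ^^ m) 0 - real m * (F ^^ n) 0\<bar> \<le> real m + real n"
    using funpow_quasi_linear[of m n] funpow_quasi_linear[of n m] by (simp add: mult.commute)
  then have "\<bar>real n * (F ^^ m) 0 - real m * (F ^^ n) 0\<bar> / (real m * real n)
       \<le> (real m + real n) / (real m * real n)"
    using assms by (intro divide_right_mono) auto
  moreover have "(F ^^ m) 0 / real m - (F ^^ n) 0 / real n
      = (real n * (F ^^ m) 0 - real m * (F ^^ n) 0) / (real m * real n)"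
    using assms by (simp add: field_simps)
  moreover have "(real m + real n) / (real m * real n) = 1 / real m + 1 / real n"
    using assms by (simp add: field_simps)
  ultimately show ?thesis by (simp add: abs_divide)
qed

lemma trans_num_LIMSEQ: "(\<lambda>n. (F ^^ n) 0 / real n) \<longlonglongrightarrow> trans_num"
proof -
  have "Cauchy (\<lambda>n. (F ^^ n) 0 / real n)"
  proof (rule metric_CauchyI)
    fix e :: real assume "0 < e"
    then obtain N :: nat where N: "0 < N" "1 / real N < e / 2"
      by (metis half_gt_zero inverse_eq_divide real_arch_inverse gr0I)
    show "\<exists>M. \<forall>m\<ge>M. \<forall>n\<ge>M. dist ((F ^^ m) 0 / real m) ((F ^^ n) 0 / real n) < e"
    proof (intro exI allI impI)
      fix m n assume "m \<ge> N" "n \<ge> N"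
      then have "1 / real m \<le> 1 / real N" "1 / real n \<le> 1 / real N" "0 < m" "0 < n"
        using N(1) by (auto intro!: divide_left_mono)
      then show "dist ((F ^^ m) 0 / real m) ((F ^^ n) 0 / real n) < e"
        using funpow_average_diff_le[of m n] N(2) unfolding dist_real_def by linarith
    qed
  qed
  then show ?thesis
    unfolding trans_num_def by (simp add: Cauchy_convergent_iff convergent_LIMSEQ_iff)
qed

lemma funpow_0_bound: "\<bar>(F ^^ n) 0 - real n * trans_num\<bar> \<le> 1"
proof (cases "n = 0")
  case False
  have "\<bar>trans_num - (F ^^ n) 0 / real n\<bar> \<le> 0 + 1 / real n"
  proof (rule tendsto_le[OF sequentially_bot])
    show "(\<lambda>m. \<bar>(F ^^ m) 0 / real m - (F ^^ n) 0 / real n\<bar>) \<longlonglongrightarrow> \<bar>trans_num - (F ^^ n) 0 / real n\<bar>"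
      by (intro tendsto_intros trans_num_LIMSEQ)
    show "(\<lambda>m. 1 / real m + 1 / real n) \<longlonglongrightarrow> 0 + 1 / real n"
      by (intro tendsto_intros lim_1_over_n)
    show "\<forall>\<^sub>F m in sequentially. \<bar>(F ^^ m) 0 / real m - (F ^^ n) 0 / real n\<bar> \<le> 1 / real m + 1 / real n"
      using eventually_gt_at_top[of 0] by eventually_elim (use False funpow_average_diff_le in auto)
  qed
  then have "real n * \<bar>trans_num - (F ^^ n) 0 / real n\<bar> \<le> 1"
    using False by (simp add: field_simps)
  then have "\<bar>real n * (trans_num - (F ^^ n) 0 / real n)\<bar> \<le> 1"
    by (simp add: abs_mult)
  then show ?thesis using False by (simp add: right_diff_distrib abs_minus_commute)
qed simp

lemma iter_bound: "\<bar>iter k x - x - of_int k * trans_num\<bar> \<le> 2"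
proof -
  have iter_nat_bound: "\<bar>iter (int n) y - y - real n * trans_num\<bar> \<le> 2" for n y
    using funpow_0_bound[of n] iter_displacement[of "int n" y 0] by (simp add: iter_nat)
  show ?thesis
  proof (cases "0 \<le> k")
    case True then show ?thesis using iter_nat_bound[of "nat k" x] by simp
  next
    case False
    then show ?thesis
      using iter_nat_bound[of "nat (- k)" "iter k x"] iter_add[of "- k" k x] by simp
  qed
qed

lemma act_bound: "\<bar>act k m x - x - (of_int k * trans_num + of_int m)\<bar> \<le> 2"
  using iter_bound[of k x] by (simp add: act_def algebra_simps)

lemma act_greater:
  assumes "0 < of_int k * trans_num + of_int m"
  shows "x < act k m x"
proof (rule ccontr)
  define c where "c = of_int k * trans_num + of_int m"
  assume not_greater: "\<not> x < act k m x"
  have act_mult_le: "act (int n * k) (int n * m) x \<le> x" for n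
  proof (induction n)
    case (Suc n)
    have "act (int (Suc n) * k) (int (Suc n) * m) x = act k m (act (int n * k) (int n * m) x)"
      by (simp add: distrib_right flip: act_add)
    also have "\<dots> \<le> act k m x" using Suc by simp
    finally show ?case using not_greater by simp
  qed simp
  obtain n :: nat where "2 < real n * c"
    using assms reals_Archimedean3 unfolding c_def by blast
  moreover have "of_int (int n * k) * trans_num + of_int (int n * m) = real n * c"
    by (simp add: c_def algebra_simps)
  ultimately show False
    using act_bound[of "int n * k" "int n * m" x] act_mult_le[of n] by linarith
qed

lemma act_less_act:
  assumes "of_int k * trans_num + of_int m < of_int k' * trans_num + of_int m'"
  shows "act k m x < act k' m' x"
proof -
  have "act k m x < act (k' - k) (m' - m) (act k m x)"
    by (rule act_greater) (use assms in \<open>simp add: algebra_simps\<close>)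
  then show ?thesis by (simp flip: act_add)
qed

lemma act_fixed_imp_trans_num:
  assumes "act k m x = x"
  shows "of_int k * trans_num + of_int m = 0"
  using act_less_act[of k m 0 0 x] act_less_act[of 0 0 k m x] assms by fastforce

end

locale circle_map = circle_lift +
  fixes f :: "complex \<Rightarrow> complex"
  assumes f_circ: "f (circ x) = circ (F x)"
begin

lemma circ_act: "circ (act k m x) = circ (iter k x)"
  by (simp add: act_def)

lemma funpow_circ: "(f ^^ n) (circ x) = circ (iter (int n) x)"
  unfolding iter_nat by (induction n) (simp_all add: f_circ)

lemma inj_on_f: "inj_on f Tcirc"
proof
  fix z w assume "z \<in> Tcirc" "w \<in> Tcirc" "f z = f w"
  then obtain x y where xy: "z = circ x" "w = circ y" by (metis Tcirc_cases)
  then obtain m :: int where "F x = F (y + of_int m)"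
    using \<open>f z = f w\<close> by (auto simp: f_circ circ_eq_iff F_shift_int)
  then have "x = y + of_int m" by (metis inv_F)
  then show "z = w" by (simp add: xy)
qed

lemma homeomorphism_f: "\<exists>f'. homeomorphism Tcirc Tcirc f f'"
proof -
  have "continuous_on {0..1} (f \<circ> circ)"
    using continuous_on_compose[OF continuous_on_act[of _ 1 0] continuous_on_circ]
    by (simp add: o_def f_circ act_def)
  then have "continuous_on Tcirc f" by (simp only: continuous_on_Tcirc_iff)
  moreover have "f ` Tcirc = Tcirc"
  proof (intro equalityI subsetI)
    fix z assume "z \<in> Tcirc"
    then obtain x where "z = circ x" by (rule Tcirc_cases)
    then have "z = f (circ (inv F x))" by (simp add: f_circ)
    then show "z \<in> f ` Tcirc" by simp
  qed (auto elim!: Tcirc_cases simp: f_circ)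
  ultimately show ?thesis using homeomorphism_compact[OF compact_sphere _ _ inj_on_f] by blast
qed

lemma inv_into_circ: "inv_into Tcirc f (circ x) = circ (inv F x)"
  using inv_into_f_f[OF inj_on_f, of "circ (inv F x)"] by (simp add: f_circ)

lemma inv_into_funpow_circ: "(inv_into Tcirc f ^^ n) (circ x) = circ (iter (- int n) x)"
  unfolding iter_neg_nat by (induction n) (simp_all add: inv_into_circ)

lemma full_orbit_circ: "full_orbit f (circ x) = range (\<lambda>k. circ (iter k x))"
proof -
  have "circ (iter k x) \<in> full_orbit f (circ x)" for k
    by (cases k rule: int_cases2) (auto simp: full_orbit_def funpow_circ inv_into_funpow_circ)
  then show ?thesis by (auto simp: full_orbit_def funpow_circ inv_into_funpow_circ)
qed

end

lemma (in circle_lift) circle_map_Arg: "circle_map F (\<lambda>z. circ (F (Arg z / (2 * pi))))"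
proof
  show "circ (F (Arg (circ x) / (2 * pi))) = circ (F x)" for x
    by (rule Arg_circ[of x]) (simp add: F_shift_int)
qed

section \<open>The semiconjugacy to a rotation\<close>

definition disjoint_mod_1 :: "'i set \<Rightarrow> ('i \<Rightarrow> real) \<Rightarrow> ('i \<Rightarrow> real) \<Rightarrow> bool" where
  "disjoint_mod_1 I lo hi \<longleftrightarrow>
    (\<forall>k\<in>I. \<forall>l\<in>I. k \<noteq> l \<longrightarrow> (\<forall>m::int. hi k + of_int m \<le> lo l \<or> hi l \<le> lo k + of_int m))"

lemma disjoint_mod_1D:
  assumes "disjoint_mod_1 I lo hi" "k \<in> I" "l \<in> I" "k \<noteq> l"
  shows "hi k + of_int m \<le> lo l \<or> hi l \<le> lo k + of_int m"
  using assms unfolding disjoint_mod_1_def by blast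

lemma sum_disjoint_mod_1_le:
  assumes "finite I" "disjoint_mod_1 I lo hi"
    and len: "\<And>i. i \<in> I \<Longrightarrow> lo i \<le> hi i \<and> hi i \<le> lo i + 1"
  shows "(\<Sum>i\<in>I. hi i - lo i) \<le> 2"
proof -
  define lo' hi' where "lo' i = lo i - of_int \<lfloor>lo i\<rfloor>" and "hi' i = hi i - of_int \<lfloor>lo i\<rfloor>" for i
  have "(\<Sum>i\<in>I. hi' i - lo' i) \<le> 2 - 0"
  proof (rule sum_nonoverlapping_le)
    fix i assume "i \<in> I"
    moreover have "0 \<le> lo' i" "lo' i < 1" unfolding lo'_def by linarith+
    ultimately show "0 \<le> lo' i \<and> lo' i \<le> hi' i \<and> hi' i \<le> 2"
      using len[of i] by (auto simp: lo'_def hi'_def)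
  next
    fix i j assume "i \<in> I" "j \<in> I" "i \<noteq> j"
    then show "hi' i \<le> lo' j \<or> hi' j \<le> lo' i"
      using disjoint_mod_1D[OF assms(2), of i j "\<lfloor>lo j\<rfloor> - \<lfloor>lo i\<rfloor>"] by (auto simp: lo'_def hi'_def)
  qed (use assms(1) in auto)
  then show ?thesis by (simp add: lo'_def hi'_def)
qed

context circle_lift
begin

definition semiconj :: "real \<Rightarrow> real" where
  "semiconj x = (SUP k. iter k x - of_int k * trans_num)"

lemma bdd_above_iter_rotated_back: "bdd_above (range (\<lambda>k. iter k x - of_int k * trans_num))"
proof (rule bdd_aboveI2)
  show "iter k x - of_int k * trans_num \<le> x + 2" for k using iter_bound[of k x] by linarith
qed

lemma semiconj_upper: "iter k x - of_int k * trans_num \<le> semiconj x"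
  unfolding semiconj_def by (rule cSUP_upper[OF _ bdd_above_iter_rotated_back]) simp

lemma mono_semiconj: "mono semiconj"
proof
  fix x y :: real assume "x \<le> y"
  then have "iter k x - of_int k * trans_num \<le> semiconj y" for k
    using semiconj_upper[of k y] iter_le_iff[of k x y] by linarith
  then show "semiconj x \<le> semiconj y" unfolding semiconj_def[of x] by (intro cSUP_least) auto
qed

lemma semiconj_act: "semiconj (act k m x) = semiconj x + of_int k * trans_num + of_int m"
proof (rule antisym)
  have semiconj_act_le: "semiconj (act k m x) \<le> semiconj x + of_int k * trans_num + of_int m" for k m x
    unfolding semiconj_def[of "act k m x"]
  proof (rule cSUP_least)
    fix j
    show "iter j (act k m x) - of_int j * trans_num \<le> semiconj x + of_int k * trans_num + of_int m"
      using semiconj_upper[of "j + k" x] by (simp add: act_def iter_shift iter_add) (simp add: algebra_simps)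
  qed simp
  then show "semiconj (act k m x) \<le> semiconj x + of_int k * trans_num + of_int m" .
  show "semiconj x + of_int k * trans_num + of_int m \<le> semiconj (act k m x)"
    using semiconj_act_le[of "- k" "- m" "act k m x"] by simp
qed

lemma semiconj_orbit_dense:
  assumes "trans_num \<notin> \<rat>" "y < z"
  obtains k m where "y < semiconj (act k m x)" "semiconj (act k m x) < z"
proof -
  have "0 < (z - y) / 2" using assms(2) by simp
  then obtain k m where "\<bar>of_int k * trans_num - of_int m - ((y + z) / 2 - semiconj x)\<bar> < (z - y) / 2"
    using sequence_of_fractional_parts_is_dense[OF assms(1)] by metis
  then show ?thesis
    using that[of k "- m"] by (simp add: semiconj_act abs_less_iff field_simps)
qed

lemma orbit_of_lifts_dense:
  assumes "trans_num \<notin> \<rat>" "strict_mono semiconj" "0 < e"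
  shows "\<exists>k m. dist (act k m x) y < e"
proof -
  have "semiconj y < semiconj (y + e)" using assms by (simp add: strict_mono_less)
  then obtain k m where "semiconj y < semiconj (act k m x)" "semiconj (act k m x) < semiconj (y + e)"
    using semiconj_orbit_dense[OF assms(1)] by blast
  then have "y < act k m x" "act k m x < y + e" using assms(2) by (simp_all add: strict_mono_less)
  then have "dist (act k m x) y < e" by (simp add: dist_real_def)
  then show ?thesis by blast
qed

lemma circle_lift_semiconj:
  assumes "trans_num \<notin> \<rat>" "strict_mono semiconj"
  shows "circle_lift semiconj"
proof
  have "continuous_on UNIV semiconj"
    using mono_semiconj semiconj_orbit_dense[OF assms(1)]
    by (intro mono_dense_range_imp_continuous_on) metis+
  then have cont: "continuous_on A semiconj" for A using continuous_on_subset by blast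
  show "surj semiconj"
  proof (rule surjI)
    fix y
    define n where "n = \<lfloor>y - semiconj 0\<rfloor>"
    have "act 0 n 0 \<le> act 0 (n + 1) 0" by (simp add: act_def)
    moreover have "semiconj (act 0 n 0) \<le> y" "y \<le> semiconj (act 0 (n + 1) 0)"
      unfolding semiconj_act n_def by linarith+
    ultimately have "\<exists>x. semiconj x = y" using IVT'[OF _ _ _ cont] by blast
    then show "semiconj (SOME x. semiconj x = y) = y" by (rule someI_ex)
  qed
  show "semiconj (x + 1) = semiconj x + 1" for x
    using semiconj_act[of 0 1 x] by (simp add: act_def)
qed (rule assms(2))

lemma plateau_act_less:
  assumes "semiconj u = semiconj v"
    and "of_int k * trans_num + of_int m < of_int k' * trans_num + of_int m'"
  shows "act k m v < act k' m' u"
proof -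
  have "semiconj (act k m v) < semiconj (act k' m' u)" using assms by (simp add: semiconj_act)
  then show ?thesis using mono_semiconj by (metis linorder_not_less monoD)
qed

lemma plateau_length_LIMSEQ:
  assumes irr: "trans_num \<notin> \<rat>" and plateau: "semiconj u = semiconj v" and "u \<le> v"
  shows "(\<lambda>n. iter (int n) v - iter (int n) u) \<longlonglongrightarrow> 0"
proof (rule summable_LIMSEQ_zero, rule summableI_nonneg_bounded)
  show "0 \<le> iter (int n) v - iter (int n) u" for n using \<open>u \<le> v\<close> by simp
  show "(\<Sum>n<N. iter (int n) v - iter (int n) u) \<le> 2" for N
  proof (rule sum_disjoint_mod_1_le)
    show "disjoint_mod_1 {..<N} (\<lambda>n. iter (int n) u) (\<lambda>n. iter (int n) v)"
      unfolding disjoint_mod_1_def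
    proof (intro ballI impI allI)
      fix k l :: nat and m assume "k \<noteq> l"
      then have "of_int (int k) * trans_num + of_int m \<noteq> of_int (int l) * trans_num + of_int 0"
        using irrational_int_combination_eq_0_iff[OF irr, of "int k - int l" m] by (simp add: algebra_simps)
      then have "act (int k) m v < act (int l) 0 u \<or> act (int l) 0 v < act (int k) m u"
        using plateau_act_less[OF plateau] by (metis linorder_neqE_linordered_idom)
      then show "iter (int k) v + of_int m \<le> iter (int l) u \<or> iter (int l) v \<le> iter (int k) u + of_int m"
        by (auto simp: act_def)
    qed
    show "iter (int n) u \<le> iter (int n) v \<and> iter (int n) v \<le> iter (int n) u + 1" for n
      using plateau_act_less[OF plateau, of "int n" 0 "int n" 1] \<open>u \<le> v\<close> by (simp add: act_def)
  qed simp
qed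

definition hull_left :: "nat \<Rightarrow> int \<Rightarrow> real \<Rightarrow> nat \<Rightarrow> real" where
  "hull_left q n u k = min (act (int k) 0 u) (act (int k - int q) n u)"

definition hull_right :: "nat \<Rightarrow> int \<Rightarrow> real \<Rightarrow> nat \<Rightarrow> real" where
  "hull_right q n v k = max (act (int k) 0 v) (act (int k - int q) n v)"

lemma closest_return_plateau_hulls_disjoint:
  assumes return: "closest_return trans_num q n" and plateau: "semiconj u = semiconj v"
  shows "disjoint_mod_1 {..<q} (hull_left q n u) (hull_right q n v)"
  unfolding disjoint_mod_1_def
proof (intro ballI impI allI)
  fix k l m assume kl: "k \<in> {..<q}" "l \<in> {..<q}" "k \<noteq> l"
  define \<delta> where "\<delta> = (real k - real l) * trans_num + of_int m"
  have far: "\<bar>real q * trans_num - of_int n\<bar> < \<bar>\<delta>\<bar>"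
    unfolding \<delta>_def using closest_return_less[OF return] kl by simp
  have act_shift: "act i j x + of_int m = act i (j + m) x" for i j x by (simp add: act_def)
  show "hull_right q n v k + of_int m \<le> hull_left q n u l \<or> hull_right q n v l \<le> hull_left q n u k + of_int m"
  proof (cases "\<delta> < 0")
    case True
    then have "act (int k) m v < act (int l) 0 u" "act (int k) m v < act (int l - int q) n u"
      "act (int k - int q) (n + m) v < act (int l) 0 u"
      "act (int k - int q) (n + m) v < act (int l - int q) n u"
      using far by (auto intro!: plateau_act_less[OF plateau]
          simp: \<delta>_def algebra_simps abs_less_iff abs_if split: if_splits)
    then show ?thesis by (simp add: hull_left_def hull_right_def act_shift max_add_distrib_left)
  next
    case False
    then have "act (int l) 0 v < act (int k) m u" "act (int l - int q) n v < act (int k) m u"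
      "act (int l) 0 v < act (int k - int q) (n + m) u"
      "act (int l - int q) n v < act (int k - int q) (n + m) u"
      using far by (auto intro!: plateau_act_less[OF plateau]
          simp: \<delta>_def algebra_simps abs_less_iff abs_if split: if_splits)
    then show ?thesis by (simp add: hull_left_def hull_right_def act_shift min_add_distrib_left)
  qed
qed

end

context circle_map
begin

lemma conjugate_to_rotation:
  assumes "trans_num \<notin> \<rat>" "strict_mono semiconj"
  shows "\<exists>H H'. homeomorphism Tcirc Tcirc H H' \<and> (\<forall>z\<in>Tcirc. H (f z) = circ trans_num * H z)"
proof -
  define H where "H z = circ (semiconj (Arg z / (2 * pi)))" for z
  have circle_map_H: "circle_map semiconj H"
    using circle_lift.circle_map_Arg[OF circle_lift_semiconj[OF assms]] by (simp add: H_def[abs_def])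
  have "H (f z) = circ trans_num * H z" if "z \<in> Tcirc" for z
  proof -
    obtain x where "z = circ x" using \<open>z \<in> Tcirc\<close> by (rule Tcirc_cases)
    then show ?thesis
      using semiconj_act[of 1 0 x] circle_map.f_circ[OF circle_map_H]
      by (simp add: f_circ act_def circ_add mult.commute)
  qed
  then show ?thesis using circle_map.homeomorphism_f[OF circle_map_H] by blast
qed

lemma full_orbit_dense:
  assumes irr: "trans_num \<notin> \<rat>" and strict: "strict_mono semiconj" and "z \<in> Tcirc"
  shows "closure (full_orbit f z) = Tcirc"
proof
  obtain x where z: "z = circ x" using \<open>z \<in> Tcirc\<close> by (rule Tcirc_cases)
  define S where "S = {act k m x | k m. True}"
  have circ_S: "circ ` S \<subseteq> closure (full_orbit f z)"
    using closure_subset by (force simp: S_def z full_orbit_circ circ_act)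
  have "\<exists>w\<in>S. dist w y < e" if "0 < e" for y e
    unfolding S_def using orbit_of_lifts_dense[OF irr strict that] by blast
  then have "closure S = UNIV" by (auto simp: closure_approachable)
  then have "circ ` UNIV \<subseteq> closure (full_orbit f z)"
    using image_closure_subset[OF continuous_on_circ closed_closure circ_S] by simp
  then show "Tcirc \<subseteq> closure (full_orbit f z)" by (auto elim!: Tcirc_cases)
  show "closure (full_orbit f z) \<subseteq> Tcirc"
    by (rule closure_minimal) (auto simp: z full_orbit_circ)
qed

end

section \<open>Denjoy theory for piecewise concave lifts\<close>

locale concave_lift = circle_lift +
  fixes a K :: real
  assumes K_pos: "0 < K"
    and F_slope_ge: "x < y \<Longrightarrow> (y - x) / K \<le> F y - F x"
    and F_slope_le: "x < y \<Longrightarrow> F y - F x \<le> K * (y - x)"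
    and F_concave: "concave_on {a..a + 1} F"
begin

definition breaks :: "nat \<Rightarrow> real set" where
  "breaks n = {act (- int j) m a | j m. j < n}"

lemma breaks_1: "breaks 1 = range (\<lambda>m. a + of_int m)"
  unfolding breaks_def by (auto simp: act_def)

lemma break_free_shift:
  assumes "{c<..<d} \<inter> breaks 1 = {}"
  obtains m :: int where "{c - of_int m..d - of_int m} \<subseteq> {a..a + 1}"
proof -
  define m where "m = \<lfloor>c - a\<rfloor>"
  have "a \<le> c - of_int m" "c < a + of_int (m + 1)" unfolding m_def by linarith+
  moreover have "a + of_int (m + 1) \<notin> {c<..<d}" using assms unfolding breaks_1 by blast
  ultimately have "{c - of_int m..d - of_int m} \<subseteq> {a..a + 1}" by auto
  then show ?thesis by (rule that)
qed

definition log_slope :: "real \<Rightarrow> real \<Rightarrow> real" where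
  "log_slope x y = ln ((F y - F x) / (y - x))"

lemma log_slope_shift: "log_slope (x + of_int m) (y + of_int m) = log_slope x y"
  by (simp add: log_slope_def F_shift_int)

lemma abs_log_slope_le:
  assumes "x < y"
  shows "\<bar>log_slope x y\<bar> \<le> ln K"
proof -
  have "1 / K \<le> (F y - F x) / (y - x)" "(F y - F x) / (y - x) \<le> K"
    using F_slope_ge[OF assms] F_slope_le[OF assms] assms K_pos by (simp_all add: field_simps)
  then have "ln (1 / K) \<le> log_slope x y" "log_slope x y \<le> ln K"
    unfolding log_slope_def using assms K_pos by (intro ln_mono; simp)+
  then show ?thesis using K_pos by (simp add: ln_div)
qed

lemma ln_K_nonneg: "0 \<le> ln K"
  using abs_log_slope_le[of 0 1] by linarith

lemma log_slope_antimono: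
  assumes "a \<le> u" "u < v" "v \<le> w" "w < z" "z \<le> a + 1"
  shows "log_slope w z \<le> log_slope u v"
  unfolding log_slope_def
  by (intro ln_mono concave_on_slope_antimono[OF F_concave]) (use assms in auto)

lemma sum_log_slope_variation_fundamental_domain:
  assumes "finite I"
    and intervals: "\<And>k. k \<in> I \<Longrightarrow> u k < v k \<and> u' k < v' k"
    and hulls: "\<And>k. k \<in> I \<Longrightarrow> a \<le> min (u k) (u' k) \<and> max (v k) (v' k) \<le> a + 1"
    and nonoverlapping: "\<And>k l. k \<in> I \<Longrightarrow> l \<in> I \<Longrightarrow> k \<noteq> l \<Longrightarrow>
      max (v k) (v' k) \<le> min (u l) (u' l) \<or> max (v l) (v' l) \<le> min (u k) (u' k)"
  shows "(\<Sum>k\<in>I. \<bar>log_slope (u k) (v k) - log_slope (u' k) (v' k)\<bar>) \<le> 2 * ln K"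
proof -
  define S S' where "S k = - log_slope (u k) (v k)" and "S' k = - log_slope (u' k) (v' k)" for k
  have ordered: "max (S k) (S' k) \<le> min (S l) (S' l)"
    if "k \<in> I" "l \<in> I" "max (v k) (v' k) \<le> min (u l) (u' l)" for k l
    using that intervals hulls[of k] hulls[of l] unfolding S_def S'_def
    by (simp add: log_slope_antimono)
  have "(\<Sum>k\<in>I. max (S k) (S' k) - min (S k) (S' k)) \<le> ln K - (- ln K)"
  proof (rule sum_nonoverlapping_le[OF \<open>finite I\<close>])
    fix k assume "k \<in> I"
    then show "- ln K \<le> min (S k) (S' k) \<and> min (S k) (S' k) \<le> max (S k) (S' k) \<and> max (S k) (S' k) \<le> ln K"
      using intervals abs_log_slope_le[of "u k" "v k"] abs_log_slope_le[of "u' k" "v' k"]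
      unfolding S_def S'_def by (auto simp: abs_le_iff)
  next
    fix k l assume "k \<in> I" "l \<in> I" "k \<noteq> l"
    then show "max (S k) (S' k) \<le> min (S l) (S' l) \<or> max (S l) (S' l) \<le> min (S k) (S' k)"
      using ordered nonoverlapping by blast
  qed (use ln_K_nonneg in simp)
  moreover have "max (S k) (S' k) - min (S k) (S' k)
      = \<bar>log_slope (u k) (v k) - log_slope (u' k) (v' k)\<bar>" for k
    unfolding S_def S'_def by linarith
  ultimately show ?thesis by simp
qed

lemma sum_log_slope_variation_break_free:
  assumes "finite I"
    and intervals: "\<And>k. k \<in> I \<Longrightarrow> u k < v k \<and> u' k < v' k"
    and disj: "disjoint_mod_1 I (\<lambda>k. min (u k) (u' k)) (\<lambda>k. max (v k) (v' k))"
    and break_free: "\<And>k. k \<in> I \<Longrightarrow> {min (u k) (u' k)<..<max (v k) (v' k)} \<inter> breaks 1 = {}"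
  shows "(\<Sum>k\<in>I. \<bar>log_slope (u k) (v k) - log_slope (u' k) (v' k)\<bar>) \<le> 2 * ln K"
proof -
  define lo hi where "lo k = min (u k) (u' k)" and "hi k = max (v k) (v' k)" for k
  have "\<exists>m::int. {lo k - of_int m..hi k - of_int m} \<subseteq> {a..a + 1}" if "k \<in> I" for k
    using break_free_shift[OF break_free[OF that]] unfolding lo_def hi_def by blast
  then obtain m :: "_ \<Rightarrow> int"
    where m: "\<And>k. k \<in> I \<Longrightarrow> {lo k - of_int (m k)..hi k - of_int (m k)} \<subseteq> {a..a + 1}"
    by metis
  define shift where "shift w k = w k + of_int (- m k)" for w :: "_ \<Rightarrow> real" and k
  have hull_shift: "min (shift u k) (shift u' k) = lo k - of_int (m k)"
    "max (shift v k) (shift v' k) = hi k - of_int (m k)" for k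
    by (simp_all add: shift_def lo_def hi_def min_def max_def)
  have "(\<Sum>k\<in>I. \<bar>log_slope (shift u k) (shift v k) - log_slope (shift u' k) (shift v' k)\<bar>) \<le> 2 * ln K"
  proof (rule sum_log_slope_variation_fundamental_domain[OF \<open>finite I\<close>], unfold hull_shift)
    fix k assume "k \<in> I"
    then have "lo k < hi k" using intervals[of k] by (auto simp: lo_def hi_def)
    then show "a \<le> lo k - of_int (m k) \<and> hi k - of_int (m k) \<le> a + 1" using m[OF \<open>k \<in> I\<close>] by simp
  next
    fix k l assume "k \<in> I" "l \<in> I" "k \<noteq> l"
    then show "hi k - of_int (m k) \<le> lo l - of_int (m l) \<or> hi l - of_int (m l) \<le> lo k - of_int (m k)"
      using disjoint_mod_1D[OF disj, of k l "m l - m k"] by (auto simp: lo_def hi_def)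
  qed (use intervals in \<open>auto simp: shift_def\<close>)
  then show ?thesis unfolding shift_def log_slope_shift .
qed

lemma disjoint_mod_1_break_unique:
  assumes disj: "disjoint_mod_1 I lo hi" "k \<in> I" "l \<in> I"
    and breaks: "{lo k<..<hi k} \<inter> breaks 1 \<noteq> {}" "{lo l<..<hi l} \<inter> breaks 1 \<noteq> {}"
  shows "k = l"
proof (rule ccontr)
  assume "k \<noteq> l"
  obtain m m' :: int where "lo k < a + of_int m" "a + of_int m < hi k"
    "lo l < a + of_int m'" "a + of_int m' < hi l"
    using breaks unfolding breaks_1 by auto
  then show False using disjoint_mod_1D[OF disj \<open>k \<noteq> l\<close>, of "m' - m"] by auto
qed

lemma sum_log_slope_variation:
  assumes "finite I"
    and intervals: "\<And>k. k \<in> I \<Longrightarrow> u k < v k \<and> u' k < v' k"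
    and disj: "disjoint_mod_1 I (\<lambda>k. min (u k) (u' k)) (\<lambda>k. max (v k) (v' k))"
  shows "(\<Sum>k\<in>I. \<bar>log_slope (u k) (v k) - log_slope (u' k) (v' k)\<bar>) \<le> 4 * ln K"
proof -
  define variation where "variation k = \<bar>log_slope (u k) (v k) - log_slope (u' k) (v' k)\<bar>" for k
  define J where "J = {k \<in> I. {min (u k) (u' k)<..<max (v k) (v' k)} \<inter> breaks 1 \<noteq> {}}"
  have "J \<subseteq> I" "finite J" using \<open>finite I\<close> by (auto simp: J_def)
  have "k = l" if "k \<in> J" "l \<in> J" for k l
    using disjoint_mod_1_break_unique[OF disj] that by (simp add: J_def)
  then have "card J \<le> 1" using \<open>finite J\<close> by (simp add: card_le_Suc0_iff_eq)
  have "variation k \<le> 2 * ln K" if "k \<in> I" for k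
    using intervals[OF that] abs_log_slope_le[of "u k" "v k"] abs_log_slope_le[of "u' k" "v' k"]
    unfolding variation_def by linarith
  then have "(\<Sum>k\<in>J. variation k) \<le> real (card J) * (2 * ln K)"
    using \<open>J \<subseteq> I\<close> by (intro sum_bounded_above) auto
  also have "\<dots> \<le> 1 * (2 * ln K)"
    using \<open>card J \<le> 1\<close> ln_K_nonneg by (intro mult_right_mono) auto
  finally have "(\<Sum>k\<in>J. variation k) \<le> 2 * ln K" by simp
  moreover have "(\<Sum>k\<in>I - J. variation k) \<le> 2 * ln K"
    unfolding variation_def
    by (rule sum_log_slope_variation_break_free)
       (use \<open>finite I\<close> intervals disj in \<open>auto simp: J_def disjoint_mod_1_def\<close>)
  moreover have "(\<Sum>k\<in>I. variation k) = (\<Sum>k\<in>I - J. variation k) + (\<Sum>k\<in>J. variation k)"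
    using \<open>J \<subseteq> I\<close> \<open>finite I\<close> by (rule sum.subset_diff)
  ultimately show ?thesis by (simp add: variation_def)
qed

lemma sum_log_slope_iter:
  assumes "u < v"
  shows "(\<Sum>k<n. log_slope (act (j + int k) m u) (act (j + int k) m v))
    = ln (iter (j + int n) v - iter (j + int n) u) - ln (iter j v - iter j u)"
proof -
  define len where "len k = iter k v - iter k u" for k
  have len_pos: "0 < len k" for k using assms by (simp add: len_def)
  have "log_slope (act k m u) (act k m v) = ln (len (k + 1) / len k)" for k
    by (simp add: log_slope_def act_def len_def F_shift_int iter_Suc)
  then have "log_slope (act k m u) (act k m v) = ln (len (k + 1)) - ln (len k)" for k
    using len_pos[of k] len_pos[of "k + 1"] by (simp add: ln_div)
  then show ?thesis
    using sum_lessThan_telescope[of "\<lambda>k. ln (len (j + int k))" n] by (simp add: len_def ac_simps)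
qed

lemma denjoy_distortion:
  assumes "u < v" and disj: "disjoint_mod_1 {..<q} (hull_left q n u) (hull_right q n v)"
  shows "2 * ln (v - u) - 4 * ln K
    \<le> ln (iter (int q) v - iter (int q) u) + ln (iter (- int q) v - iter (- int q) u)"
proof -
  define S S' where "S k = log_slope (act (int k) 0 u) (act (int k) 0 v)"
    and "S' k = log_slope (act (int k - int q) n u) (act (int k - int q) n v)" for k
  have "(\<Sum>k<q. S k) = ln (iter (int q) v - iter (int q) u) - ln (v - u)"
    using sum_log_slope_iter[OF \<open>u < v\<close>, where j = 0] by (simp add: S_def)
  moreover have "(\<Sum>k<q. S' k) = ln (v - u) - ln (iter (- int q) v - iter (- int q) u)"
    using sum_log_slope_iter[OF \<open>u < v\<close>, where j = "- int q"] by (simp add: S'_def)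
  moreover have "(\<Sum>k<q. S' k) - (\<Sum>k<q. S k) \<le> (\<Sum>k<q. \<bar>S k - S' k\<bar>)"
    unfolding sum_subtractf[symmetric] by (intro sum_mono) simp
  moreover have "\<dots> \<le> 4 * ln K"
    unfolding S_def S'_def
    by (rule sum_log_slope_variation)
       (use \<open>u < v\<close> disj in \<open>simp_all add: hull_left_def[abs_def] hull_right_def[abs_def]\<close>)
  ultimately show ?thesis by linarith
qed

lemma strict_mono_semiconj:
  assumes irr: "trans_num \<notin> \<rat>"
  shows "strict_mono semiconj"
proof
  fix u v :: real assume "u < v"
  have "semiconj u \<noteq> semiconj v"
  proof
    assume plateau: "semiconj u = semiconj v"
    define len where "len k = iter k v - iter k u" for k
    have len_pos: "0 < len k" for k using \<open>u < v\<close> by (simp add: len_def)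
    define \<epsilon> where "\<epsilon> = exp (2 * ln (v - u) - 4 * ln K)"
    have "\<forall>\<^sub>F n in sequentially. len (int n) < \<epsilon>"
      using plateau_length_LIMSEQ[OF irr plateau] \<open>u < v\<close>
      unfolding len_def \<epsilon>_def by (intro order_tendstoD(2)) auto
    then obtain N where N: "\<And>n. n \<ge> N \<Longrightarrow> len (int n) < \<epsilon>"
      by (auto simp: eventually_sequentially)
    obtain q n where return: "N < q" "closest_return trans_num q n"
      by (rule closest_return_exists[OF irr])
    have "2 * ln (v - u) - 4 * ln K \<le> ln (len (int q)) + ln (len (- int q))"
      unfolding len_def
      by (rule denjoy_distortion[OF \<open>u < v\<close>
            closest_return_plateau_hulls_disjoint[OF return(2) plateau]])
    moreover have "ln (len (int q)) < ln \<epsilon>"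
      using N[of q] return(1) len_pos by (subst ln_less_cancel_iff) (auto simp: \<epsilon>_def)
    moreover have "len (- int q) < 1"
      using plateau_act_less[OF plateau, of "- int q" 0 "- int q" 1] by (simp add: act_def len_def)
    then have "ln (len (- int q)) < 0" using len_pos by simp
    ultimately show False by (simp add: \<epsilon>_def)
  qed
  then show "semiconj u < semiconj v"
    using \<open>u < v\<close> mono_semiconj by (metis less_imp_le monoD order_le_less)
qed

end

section \<open>Rational rotation number\<close>

lemma gap_dynamics_cong:
  assumes "0 < q"
    and "\<And>i. i < q \<Longrightarrow> lo i = lo' i" "\<And>i. i < q \<Longrightarrow> hi i = hi' i"
    and "\<And>i. i < q \<Longrightarrow> att i = att' i" "\<And>i. i < q \<Longrightarrow> rep i = rep' i"
  shows "gap_dynamics f p q lo hi att rep \<longleftrightarrow> gap_dynamics f p q lo' hi' att' rep'"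
  using assms unfolding gap_dynamics_def by simp

locale rational_circle_map = circle_map +
  fixes p q :: nat and P r s :: int
  assumes q_pos: "0 < q"
    and trans_num_eq: "real q * trans_num = of_int P"
    and P_cong: "P mod int q = int p mod int q"
    and bezout: "r * P + s * int q = 1"
begin

text \<open>By Bezout's identity \<open>step 1\<close> and \<open>ret 1\<close> form a basis of the group of lifts. Their translation
  numbers are \<open>1/q\<close> and 0, so \<open>step 1\<close> moves a periodic point to the next point of its own orbit.\<close>

definition step :: "int \<Rightarrow> real \<Rightarrow> real" where
  "step i = act (r * i) (s * i)"

abbreviation step_orbit :: "real \<Rightarrow> nat \<Rightarrow> real" where
  "step_orbit x \<equiv> \<lambda>i. step (int i) x"

definition ret :: "int \<Rightarrow> real \<Rightarrow> real" where
  "ret i = act (int q * i) (- (P * i))"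

definition per :: "real set" where
  "per = {x. ret 1 x = x}"

lemma mem_per_iff: "x \<in> per \<longleftrightarrow> iter (int q) x = x + of_int P"
  by (auto simp: per_def ret_def act_def)

lemma step_0 [simp]: "step 0 x = x"
  by (simp add: step_def)

lemma ret_0 [simp]: "ret 0 x = x"
  by (simp add: ret_def)

lemma step_add: "step (i + j) x = step i (step j x)"
  by (simp add: step_def distrib_left act_add)

lemma ret_add: "ret (i + j) x = ret i (ret j x)"
  by (simp add: ret_def distrib_left flip: act_add)

lemma ret_act: "ret i (act k m x) = act k m (ret i x)"
  unfolding ret_def by (rule act_commute)

lemma ret_step: "ret i (step j x) = step j (ret i x)"
  unfolding step_def by (rule ret_act)

lemma act_eq_step_ret: "act k m x = step (k * P + m * int q) (ret (k * s - m * r) x)"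
proof -
  have "r * (k * P + m * int q) + int q * (k * s - m * r) = k * (r * P + s * int q)"
    "s * (k * P + m * int q) + - (P * (k * s - m * r)) = m * (r * P + s * int q)"
    by (simp_all add: algebra_simps)
  then show ?thesis by (simp add: step_def ret_def bezout flip: act_add)
qed

lemma step_shift: "step i (x + of_int m) = step i x + of_int m"
  by (simp add: step_def act_def iter_shift)

lemma step_mult_q: "step (int q * k) x = ret (r * k) x + of_int k"
proof -
  have "s * (int q * k) + P * (r * k) = k * (r * P + s * int q)" by (simp add: algebra_simps)
  then have "s * (int q * k) = k - P * (r * k)" by (simp add: bezout)
  then have "step (int q * k) x = act (int q * (r * k)) (k - P * (r * k)) x"
    by (simp add: step_def mult.left_commute[of r])
  then show ?thesis by (simp add: ret_def act_def)
qed

lemma step_uminus [simp]: "step i (step (- i) x) = x" "step (- i) (step i x) = x"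
  by (simp_all flip: step_add)

lemma ret_uminus [simp]: "ret i (ret (- i) x) = x"
  by (simp flip: ret_add)

lemma step_less_iff [simp]: "step i x < step i y \<longleftrightarrow> x < y"
  by (simp add: step_def)

lemma step_le_iff [simp]: "step i x \<le> step i y \<longleftrightarrow> x \<le> y"
  by (simp add: step_def)

lemma ret_less_iff [simp]: "ret i x < ret i y \<longleftrightarrow> x < y"
  by (simp add: ret_def)

lemma step_greaterThanLessThan: "step i ` {x<..<y} = {step i x<..<step i y}"
  and step_atLeastAtMost: "step i ` {x..y} = {step i x..step i y}"
proof -
  have preimage: "w \<in> step i ` S" if "step (- i) w \<in> S" for w S
    using that by (metis image_eqI step_uminus(1))
  have "step i x < w \<longleftrightarrow> x < step (- i) w" "w < step i y \<longleftrightarrow> step (- i) w < y"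
    "step i x \<le> w \<longleftrightarrow> x \<le> step (- i) w" "w \<le> step i y \<longleftrightarrow> step (- i) w \<le> y" for w
    by (metis step_less_iff step_le_iff step_uminus(1))+
  then show "step i ` {x<..<y} = {step i x<..<step i y}" "step i ` {x..y} = {step i x..step i y}"
    by (auto intro!: preimage)
qed

lemma continuous_on_step: "continuous_on A (step i)"
  unfolding step_def by (rule continuous_on_act)

lemma continuous_on_ret: "continuous_on A (ret i)"
  unfolding ret_def by (rule continuous_on_act)

lemma trans_num_quotient: "trans_num = of_int P / real q"
  using trans_num_eq q_pos by (simp add: field_simps)

lemma step_index_less: "i < j \<Longrightarrow> step i x < step j x"
proof -
  have "of_int (r * k) * trans_num + of_int (s * k) = of_int k / real q" for k
  proof -
    have "of_int (r * k) * trans_num + of_int (s * k) = of_int (k * (r * P + s * int q)) / real q"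
      using q_pos by (simp add: trans_num_quotient field_simps)
    then show ?thesis by (simp add: bezout)
  qed
  moreover assume "i < j"
  ultimately show ?thesis
    unfolding step_def using q_pos by (intro act_less_act) (simp add: divide_strict_right_mono)
qed

lemma step_index_le_iff: "step i x \<le> step j x \<longleftrightarrow> i \<le> j"
  using step_index_less[of i j x] step_index_less[of j i x] by (cases i j rule: linorder_cases) auto

lemma ret_bound: "\<bar>ret i x - x\<bar> \<le> 2"
  using act_bound[of "int q * i" "- (P * i)" x] q_pos by (simp add: ret_def trans_num_quotient)

lemma ret_mult_greater:
  assumes "x < ret i x"
  shows "x < ret (int (Suc n) * i) x"
proof (induction n)
  case (Suc n)
  have "x < ret i x" by (rule assms)
  also have "\<dots> < ret i (ret (int (Suc n) * i) x)" using Suc by simp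
  also have "\<dots> = ret (int (Suc (Suc n)) * i) x" by (simp add: distrib_right flip: ret_add)
  finally show ?case .
qed (use assms in simp)

lemma ret_less_self_iff: "ret i x < x \<longleftrightarrow> x < ret (- i) x"
  using ret_less_iff[of i x "ret (- i) x"] by simp

lemma ret_fixed_imp_per:
  assumes "ret i x = x" "0 < i"
  shows "x \<in> per"
proof -
  obtain n where i: "i = int (Suc n)" using \<open>0 < i\<close> by (metis gr0_conv_Suc pos_int_cases)
  have "\<not> x < ret 1 x" "\<not> x < ret (- 1) x"
    using ret_mult_greater[of x 1 n] ret_mult_greater[of x "- 1" n] ret_less_self_iff[of i x] assms(1)
    unfolding i by auto
  then show ?thesis using ret_less_self_iff[of 1 x] by (auto simp: per_def)
qed

lemma ret_per:
  assumes "x \<in> per"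
  shows "ret i x = x"
proof (induction i rule: int_induct[where k = 0])
  case (step1 i) then show ?case using assms by (simp add: ret_add per_def)
next
  case (step2 i) then show ?case using assms ret_add[of "i - 1" 1 x] by (simp add: per_def)
qed simp

lemma per_act_iff [simp]: "act k m x \<in> per \<longleftrightarrow> x \<in> per"
  by (simp add: per_def ret_act)

lemma per_step_iff [simp]: "step i x \<in> per \<longleftrightarrow> x \<in> per"
  by (simp add: step_def)

lemma step_cover:
  assumes "y \<in> per"
  obtains i where "y \<le> step (- i) x" "step (- i) x < step 1 y"
proof -
  define k where "k = \<lfloor>x - y\<rfloor>"
  have "step (int q * k) y = y + of_int k" "step (int q * (k + 1)) y = y + of_int (k + 1)"
    unfolding step_mult_q ret_per[OF assms] by simp_all
  then have "step (int q * k + int 0) y \<le> x" "x < step (int q * k + int q) y"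
    unfolding k_def by (simp_all add: distrib_left) linarith+
  then obtain n where "\<not> x < step (int q * k + int n) y" "x < step (int q * k + int (n + 1)) y"
    using ex_least_nat_less[of "\<lambda>n. x < step (int q * k + int n) y" q] by force
  then have "step (int q * k + int n) y \<le> x" "x < step (int q * k + int n) (step 1 y)"
    by (simp_all flip: step_add add: ac_simps)
  then show ?thesis
    using that[of "int q * k + int n"] by (metis step_le_iff step_less_iff step_uminus(1))
qed

lemma closed_per: "closed per"
  unfolding per_def by (intro closed_Collect_eq continuous_on_ret continuous_on_id)

lemma per_nonempty: "per \<noteq> {}"
proof -
  define t where "t n = ret (int n) 0" for n
  have "t n \<le> t (Suc n) \<longleftrightarrow> 0 \<le> ret 1 0" for n
    using ret_less_iff[of "int n" "ret 1 0" 0]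
    by (simp add: t_def add.commute[of 1] ret_add not_less[symmetric])
  then have "monoseq t" unfolding monoseq_Suc by (metis linear)
  moreover have "Bseq t" using ret_bound[of _ 0] by (intro BseqI'[of _ 2]) (simp add: t_def)
  ultimately obtain L where L: "t \<longlonglongrightarrow> L" using Bseq_monoseq_convergent convergentD by blast
  have "(\<lambda>n. ret 1 (t n)) \<longlonglongrightarrow> ret 1 L"
    by (rule continuous_on_tendsto_compose[OF continuous_on_ret[of UNIV] L]) auto
  moreover have "ret 1 (t n) = t (Suc n)" for n by (simp add: t_def flip: ret_add)
  ultimately have "ret 1 L = L" using LIMSEQ_Suc[OF L] LIMSEQ_unique by simp
  then show ?thesis by (auto simp: per_def)
qed

lemma ret_gap:
  assumes "y \<in> per" "y' \<in> per" "x \<in> {y<..<y'}"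
  shows "ret i x \<in> {y<..<y'}"
  using assms ret_less_iff[of i y x] ret_less_iff[of i x y'] by (simp add: ret_per)

lemma ret_gap_LIMSEQ:
  assumes y: "y \<in> per" "y' \<in> per" and x: "x \<in> {y<..<y'}"
    and moves_right: "\<And>w. w \<in> {y<..<y'} \<Longrightarrow> w < ret i w"
  shows "(\<lambda>n. ret (int n * i) x) \<longlonglongrightarrow> y'" "(\<lambda>n. ret (int n * - i) x) \<longlonglongrightarrow> y"
proof -
  have ret_mult_Suc: "ret (int (Suc n) * j) x = ret j (ret (int n * j) x)" for n j
    by (simp add: distrib_right flip: ret_add)
  show "(\<lambda>n. ret (int n * i) x) \<longlonglongrightarrow> y'"
  proof (rule iterate_LIMSEQ_right[where G = "ret i"])
    show "w < ret i w \<and> ret i w < y'" if "w \<in> {y<..<y'}" for w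
      using moves_right[OF that] ret_gap[OF y that, of i] by simp
  qed (use x continuous_on_ret in \<open>simp_all only: ret_mult_Suc, simp_all\<close>)
  show "(\<lambda>n. ret (int n * - i) x) \<longlonglongrightarrow> y"
  proof (rule iterate_LIMSEQ_left[where G = "ret (- i)"])
    show "y < ret (- i) w \<and> ret (- i) w < w" if "w \<in> {y<..<y'}" for w
      using moves_right[OF that] ret_gap[OF y that, of "- i"] ret_less_self_iff[of "- i" w] by simp
  qed (use x continuous_on_ret in \<open>simp_all only: ret_mult_Suc, simp_all\<close>)
qed

definition sector :: "real set \<Rightarrow> nat \<Rightarrow> complex set" where
  "sector A i = circ ` step (int i) ` A"

lemma sector_singleton: "sector {x} i = {circ (step (int i) x)}"
  by (simp add: sector_def)

lemma sector_greaterThanLessThan: "sector {x<..<y} i = oarc (step (int i) x) (step (int i) y)"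
  by (simp add: sector_def oarc_def step_greaterThanLessThan)

lemma sector_atLeastAtMost: "sector {x..y} i = carc (step (int i) x) (step (int i) y)"
  by (simp add: sector_def carc_def step_atLeastAtMost)

lemma funpow_circ_step:
  "\<exists>j. \<forall>x. (f ^^ n) (circ (step (int i) x)) = circ (step (int ((i + p * n) mod q)) (ret j x))"
proof -
  define i' where "i' = (i + p * n) mod q"
  have "(int i + int n * P) mod int q = (int i + int n * int p) mod int q"
    by (metis P_cong mod_add_cong mod_mult_cong)
  also have "\<dots> = int i'" by (simp add: i'_def zmod_int mult.commute)
  finally obtain k where k: "int i + int n * P = int i' + int q * k"
    by (metis mult_div_mod_eq add.commute)
  have "(f ^^ n) (circ (step (int i) x)) = circ (step (int i') (ret (r * k + int n * s) x))" for x
  proof -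
    have "(f ^^ n) (circ (step (int i) x)) = circ (act (int n) 0 (step (int i) x))"
      by (simp only: funpow_circ circ_act)
    also have "act (int n) 0 (step (int i) x) = step (int i) (act (int n) 0 x)"
      unfolding step_def by (rule act_commute)
    also have "act (int n) 0 x = step (int n * P) (ret (int n * s) x)"
      using act_eq_step_ret[of "int n" 0 x] by simp
    also have "step (int i) (step (int n * P) y) = step (int i') (ret (r * k) y) + of_int k" for y
      unfolding step_add[symmetric] k unfolding step_add step_mult_q by (rule step_shift)
    finally show ?thesis by (simp add: ret_add)
  qed
  then show ?thesis unfolding i'_def by blast
qed

lemma funpow_sector:
  assumes "\<And>j. ret j ` A \<subseteq> A"
  shows "(f ^^ n) ` sector A i = sector A ((i + p * n) mod q)"
proof -
  obtain j where j: "\<And>x. (f ^^ n) (circ (step (int i) x)) = circ (step (int ((i + p * n) mod q)) (ret j x))"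
    using funpow_circ_step by blast
  have "A \<subseteq> ret j ` A"
  proof
    fix x assume "x \<in> A"
    then have "ret (- j) x \<in> A" using assms by blast
    then show "x \<in> ret j ` A" by (metis image_eqI ret_uminus)
  qed
  then have "ret j ` A = A" using assms by blast
  then have "sector A ((i + p * n) mod q) = circ ` step (int ((i + p * n) mod q)) ` ret j ` A"
    by (simp add: sector_def)
  also have "\<dots> = (f ^^ n) ` sector A i"
    by (simp add: sector_def image_image j)
  finally show ?thesis by simp
qed

lemma circ_mem_sector:
  assumes "step (- i) x \<in> A" "x \<in> per"
  shows "\<exists>j<q. circ x \<in> sector A j"
proof (intro exI conjI)
  define j where "j = nat (i mod int q)"
  show "j < q" using q_pos by (simp add: j_def nat_less_iff)
  have "int j = i mod int q" using q_pos by (simp add: j_def)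
  then have i: "i = int j + int q * (i div int q)" by simp
  define y where "y = step (- i) x"
  have "x = step i y" by (simp add: y_def)
  also have "\<dots> = step (int j) y + of_int (i div int q)"
    using assms(2) by (subst i) (simp add: step_add step_mult_q ret_per step_shift y_def)
  finally have "circ x = circ (step (int j) y)" by simp
  then show "circ x \<in> sector A j" using assms(1) by (simp add: sector_def y_def)
qed

lemma funpow_fixed_imp_per:
  assumes "0 < n" "(f ^^ n) (circ x) = circ x"
  shows "x \<in> per"
proof -
  obtain k :: int where "iter (int n) x = x + of_int k"
    using assms(2) by (auto simp: funpow_circ circ_eq_iff)
  then have fixed: "act (int n) (- k) x = x" by (simp add: act_def)
  then have "real n * trans_num = of_int k" using act_fixed_imp_trans_num[OF fixed] by simp
  then have "real_of_int (int n * P) = real_of_int (k * int q)"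
    using q_pos by (simp add: trans_num_quotient field_simps)
  then have nP: "int n * P = k * int q" by (simp only: of_int_eq_iff)
  define j where "j = int n * s + k * r"
  have "int n = int n * (r * P + s * int q)" by (simp add: bezout)
  also have "\<dots> = r * (int n * P) + int n * s * int q" by (simp add: algebra_simps)
  also have "\<dots> = j * int q" unfolding nP j_def by (simp add: algebra_simps)
  finally have "0 < j * int q" using \<open>0 < n\<close> by simp
  then have "0 < j" by (simp add: zero_less_mult_iff)
  have "ret j x = x"
    using act_eq_step_ret[of "int n" "- k" x] fixed by (simp add: nP j_def)
  then show ?thesis using \<open>0 < j\<close> by (rule ret_fixed_imp_per)
qed

lemma circ_ret: "circ (ret j x) = circ (iter (int q * j) x)"
  unfolding ret_def by (rule circ_act)

lemma per_funpow_fixed: "x \<in> per \<Longrightarrow> (f ^^ q) (circ x) = circ x"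
  by (metis circ_ret funpow_circ mult.right_neutral ret_per)

lemma periodic_structure_sector:
  assumes sub: "A \<subseteq> per" "A' \<subseteq> per" and cover: "\<And>x. x \<in> per \<Longrightarrow> \<exists>i. step (- i) x \<in> A \<union> A'"
  shows "periodic_structure f p q (sector A) (sector A')"
  unfolding periodic_structure_def
proof (intro conjI allI impI ballI)
  show "(f ^^ q) z = z" if "z \<in> sector A i \<union> sector A' i" for i z
    using that sub per_funpow_fixed by (auto simp: sector_def)
  show "(f ^^ n) ` sector A i = sector A ((i + p * n) mod q)"
    "(f ^^ n) ` sector A' i = sector A' ((i + p * n) mod q)" for i n
    using sub by (intro funpow_sector; auto simp: ret_per subset_iff)+
  fix z and n :: nat
  assume z: "z \<in> Tcirc - ((\<Union>i<q. sector A i) \<union> (\<Union>i<q. sector A' i))" and "0 < n"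
  show "(f ^^ n) z \<noteq> z"
  proof
    assume "(f ^^ n) z = z"
    obtain x where x: "z = circ x" using z Tcirc_cases by blast
    then have "x \<in> per" using \<open>(f ^^ n) z = z\<close> \<open>0 < n\<close> funpow_fixed_imp_per by blast
    then obtain i where "step (- i) x \<in> A \<or> step (- i) x \<in> A'" using cover by blast
    then have "\<exists>j<q. circ x \<in> sector A j \<union> sector A' j"
      using circ_mem_sector[OF _ \<open>x \<in> per\<close>] by (metis Un_iff)
    then show False using z x by blast
  qed
qed

lemma gap_dynamics_sector:
  assumes y: "y \<in> per" "y' \<in> per"
    and forward: "\<And>x. x \<in> {y<..<y'} \<Longrightarrow> (\<lambda>n. ret (int n) x) \<longlonglongrightarrow> w"
    and backward: "\<And>x. x \<in> {y<..<y'} \<Longrightarrow> (\<lambda>n. ret (- int n) x) \<longlonglongrightarrow> w'"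
  shows "gap_dynamics f p q (step_orbit y) (step_orbit y') (step_orbit w) (step_orbit w')"
  unfolding gap_dynamics_def sector_greaterThanLessThan[symmetric]
proof (intro allI impI ballI conjI)
  fix i z assume z: "z \<in> sector {y<..<y'} i"
  then obtain x where x: "x \<in> {y<..<y'}" "z = circ (step (int i) x)" by (auto simp: sector_def)
  have "ret j ` {y<..<y'} \<subseteq> {y<..<y'}" for j using ret_gap[OF y] by blast
  then show "(f ^^ n) z \<in> sector {y<..<y'} ((i + p * n) mod q)" for n
    using z funpow_sector by blast
  have iter_step: "circ (iter (int q * j) (step (int i) x)) = circ (step (int i) (ret j x))" for j
    by (simp only: circ_ret flip: ret_step)
  have tendsto_circ_step: "(\<lambda>n. circ (step (int i) (t n))) \<longlonglongrightarrow> circ (step (int i) l)" if "t \<longlonglongrightarrow> l" for t l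
    using that by (intro tendsto_circ continuous_on_tendsto_compose[OF continuous_on_step[of UNIV]]) auto
  show "(\<lambda>n. (f ^^ (n * q)) z) \<longlonglongrightarrow> circ (step (int i) w)"
    using tendsto_circ_step[OF forward[OF x(1)]] iter_step[of "int _"]
    by (simp add: x(2) funpow_circ mult.commute)
  show "(\<lambda>n. (inv_into Tcirc f ^^ (n * q)) z) \<longlonglongrightarrow> circ (step (int i) w')"
    using tendsto_circ_step[OF backward[OF x(1)]] iter_step[of "- int _"]
    by (simp add: x(2) inv_into_funpow_circ mult.commute)
qed

lemma nxt_step:
  assumes "x \<in> per" "i < q"
  shows "nxt q (step_orbit x) i = step (int i) (step 1 x)"
proof (cases "i + 1 < q")
  case False
  then have "int i + 1 = int q * 1" using assms(2) by simp
  then have "step (int i + 1) x = step (int q * 1) x" by (simp only:)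
  also have "\<dots> = x + 1" unfolding step_mult_q ret_per[OF assms(1)] by simp
  finally show ?thesis using False by (simp add: nxt_def step_add)
qed (simp add: nxt_def add.commute flip: step_add)

lemma gap_dynamics_right:
  assumes "y \<in> per" "y' \<in> per" "\<And>x. x \<in> {y<..<y'} \<Longrightarrow> x < ret 1 x"
  shows "gap_dynamics f p q (step_orbit y) (step_orbit y') (step_orbit y') (step_orbit y)"
  using ret_gap_LIMSEQ[of y y' _ 1] assms by (intro gap_dynamics_sector) simp_all

lemma gap_dynamics_nxt_left:
  assumes y: "y \<in> per" "y' \<in> per" and left: "\<And>x. x \<in> {y<..<step 1 y'} \<Longrightarrow> ret 1 x < x"
  shows "gap_dynamics f p q (step_orbit y) (nxt q (step_orbit y')) (step_orbit y) (nxt q (step_orbit y'))"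
proof -
  have "gap_dynamics f p q (step_orbit y) (step_orbit (step 1 y')) (step_orbit y) (step_orbit (step 1 y'))"
    using ret_gap_LIMSEQ[of y "step 1 y'" _ "- 1"] y left
    by (intro gap_dynamics_sector) (simp_all add: ret_less_self_iff)
  then show ?thesis
    by (rule gap_dynamics_cong[THEN iffD1, rotated -1]) (use q_pos nxt_step[OF y(2)] in simp_all)
qed

lemma case_aI:
  assumes mem_per: "xm \<in> per" "xp \<in> per" and order: "xm \<le> xp" "xp \<le> step 1 xm"
    and right: "\<And>x. x \<in> {xm<..<xp} \<Longrightarrow> x < ret 1 x"
    and left: "\<And>x. x \<in> {xp<..<step 1 xm} \<Longrightarrow> ret 1 x < x"
  shows "case_a f p q"
  unfolding case_a_def sector_singleton[symmetric]
proof (intro exI conjI allI impI)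
  show "step (int i) xm \<le> step (int i) xp" for i using order(1) by simp
  show "step (int i) xp \<le> nxt q (step_orbit xm) i" if "i < q" for i
    using order(2) nxt_step[OF mem_per(1) that] by simp
  have "\<exists>i. step (- i) x \<in> {xp} \<union> {xm}" if "x \<in> per" for x
  proof -
    obtain i where "xm \<le> step (- i) x" "step (- i) x < step 1 xm" by (rule step_cover[OF mem_per(1)])
    moreover have "ret 1 (step (- i) x) = step (- i) x" using that by (simp add: ret_step per_def)
    ultimately have "step (- i) x = xm \<or> step (- i) x = xp"
      using right[of "step (- i) x"] left[of "step (- i) x"] by fastforce
    then show ?thesis by blast
  qed
  then have "periodic_structure f p q (sector {xp}) (sector {xm})"
    using mem_per by (intro periodic_structure_sector) auto
  then show "periodic_structure f p q (\<lambda>i. {circ (step (int i) xp)}) (\<lambda>i. {circ (step (int i) xm)})"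
    by (simp add: sector_singleton[abs_def])
qed (use gap_dynamics_right[OF mem_per right] gap_dynamics_nxt_left[OF mem_per(2,1) left] in auto)

lemma case_bI:
  assumes "xL < xR" "xR \<le> step 1 xL" and sub: "{xL..xR} \<subseteq> per"
    and left: "\<And>x. x \<in> {xR<..<step 1 xL} \<Longrightarrow> ret 1 x < x"
  shows "case_b f p q"
  unfolding case_b_def
proof (intro exI conjI allI impI)
  have mem_per: "xL \<in> per" "xR \<in> per" using assms(1) sub by auto
  note nxt = nxt_step[OF mem_per(1)]
  show "step_orbit xL i < step_orbit xR i" for i using assms(1) by simp
  show "step_orbit xR i \<le> nxt q (step_orbit xL) i" if "i < q" for i using assms(2) nxt[OF that] by simp
  have cover: "\<exists>i. step (- i) x \<in> {xL..xR}" if "xR = step 1 xL \<or> x \<in> per" for x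
  proof -
    obtain i where i: "xL \<le> step (- i) x" "step (- i) x < step 1 xL" by (rule step_cover[OF mem_per(1)])
    then have "step (- i) x \<le> xR"
      using left[of "step (- i) x"] that by (fastforce simp: ret_step per_def)
    then show ?thesis using i(1) by auto
  qed
  have "periodic_structure f p q (sector {xL..xR}) (sector {xL..xR})"
    using sub cover by (intro periodic_structure_sector) auto
  then show "periodic_structure f p q
      (\<lambda>i. carc (step_orbit xL i) (step_orbit xR i)) (\<lambda>i. carc (step_orbit xL i) (step_orbit xR i))"
    by (simp add: sector_atLeastAtMost[abs_def])
  show "(\<forall>i<q. step_orbit xR i < nxt q (step_orbit xL) i)
      \<or> (\<forall>i<q. step_orbit xR i = nxt q (step_orbit xL) i)"
    using nxt assms(2) by (cases "xR = step 1 xL") auto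
  show "gap_dynamics f p q (step_orbit xR) (nxt q (step_orbit xL)) (step_orbit xR) (nxt q (step_orbit xL))"
    by (rule gap_dynamics_nxt_left[OF mem_per(2,1) left])
  show "\<forall>z\<in>Tcirc. \<exists>n>0. (f ^^ n) z = z" if eq: "\<forall>i<q. step_orbit xR i = nxt q (step_orbit xL) i"
  proof
    fix z assume "z \<in> Tcirc"
    then obtain x where x: "z = circ x" by (rule Tcirc_cases)
    have "xR = step 1 xL" using eq nxt[of 0] q_pos by auto
    then have "x \<in> per" using cover sub per_step_iff by blast
    then show "\<exists>n>0. (f ^^ n) z = z" using x q_pos per_funpow_fixed by blast
  qed
qed

end

section \<open>Periodic points of concave lifts\<close>

context concave_lift
begin

lemma mono_F: "mono F"
  using F_strict_mono by (rule strict_mono_mono)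

lemma F_conj_translation: "(\<lambda>x. (F \<circ> (\<lambda>x. x - of_int m)) x + of_int m) = F"
proof
  show "(F \<circ> (\<lambda>x. x - of_int m)) x + of_int m = F x" for x
    using F_shift_int[of "x - of_int m" m] by simp
qed

lemma concave_on_F:
  assumes "{c<..<d} \<inter> breaks 1 = {}"
  shows "concave_on {c..d} F"
proof -
  obtain m :: int where m: "{c - of_int m..d - of_int m} \<subseteq> {a..a + 1}"
    using break_free_shift[OF assms] .
  have "concave_on {c..d} (F \<circ> (\<lambda>x. x - of_int m))"
    by (rule concave_on_compose[OF F_concave mono_F concave_on_translate]) (use m in force)
  then have "concave_on {c..d} (\<lambda>x. (F \<circ> (\<lambda>x. x - of_int m)) x + of_int m)"
    by (rule concave_on_add) (simp add: concave_on_const)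
  then show ?thesis unfolding F_conj_translation .
qed

lemma strictly_concave_on_F:
  assumes strict: "strictly_concave_on {a..a + 1} F" and "{c<..<d} \<inter> breaks 1 = {}"
  shows "strictly_concave_on {c..d} F"
proof -
  obtain m :: int where m: "{c - of_int m..d - of_int m} \<subseteq> {a..a + 1}"
    using break_free_shift[OF assms(2)] .
  have "strictly_concave_on {c..d} (F \<circ> (\<lambda>x. x - of_int m))"
    by (rule strictly_concave_on_compose[OF strict mono_F concave_on_translate])
       (use m in \<open>force simp: inj_on_def\<close>)+
  then have "strictly_concave_on {c..d} (\<lambda>x. (F \<circ> (\<lambda>x. x - of_int m)) x + of_int m)"
    unfolding strictly_concave_on_def by (simp add: algebra_simps)
  then show ?thesis unfolding F_conj_translation .
qed

lemma breaksI: "j < n \<Longrightarrow> act (- int j) m a \<in> breaks n"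
  by (auto simp: breaks_def)

lemma breaks_subset_Suc: "breaks n \<subseteq> breaks (Suc n)"
  by (force simp: breaks_def)

lemma breaks_Suc_image:
  assumes "{c<..<d} \<inter> breaks (Suc n) = {}"
  shows "{iter (int n) c<..<iter (int n) d} \<inter> breaks 1 = {}"
proof -
  have "a + of_int m \<notin> {iter (int n) c<..<iter (int n) d}" for m
  proof -
    have "iter (int n) (act (- int n) m a) = a + of_int m"
      by (simp add: act_def iter_shift flip: iter_add)
    moreover have "act (- int n) m a \<notin> {c<..<d}" using assms breaksI[of n "Suc n" m] by blast
    ultimately show ?thesis by (metis greaterThanLessThan_iff iter_less_iff)
  qed
  then show ?thesis unfolding breaks_1 by blast
qed

lemma concave_on_iter:
  assumes "{c<..<d} \<inter> breaks n = {}"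
  shows "concave_on {c..d} (iter (int n))"
  using assms
proof (induction n)
  case 0
  then show ?case by (simp add: concave_on_iff)
next
  case (Suc n)
  have "concave_on {c..d} (iter (int n))" using Suc breaks_subset_Suc by blast
  then have "concave_on {c..d} (F \<circ> iter (int n))"
    by (rule concave_on_compose[OF concave_on_F[OF breaks_Suc_image[OF Suc.prems]] mono_F]) auto
  then show ?case by (simp add: o_def add.commute[of 1] flip: iter_Suc)
qed

lemma strictly_concave_on_iter_Suc:
  assumes strict: "strictly_concave_on {a..a + 1} F" and "{c<..<d} \<inter> breaks (Suc n) = {}"
  shows "strictly_concave_on {c..d} (iter (int (Suc n)))"
proof -
  note outer = strictly_concave_on_F[OF strict breaks_Suc_image[OF assms(2)]]
  have "concave_on {c..d} (iter (int n))"
    using assms(2) breaks_subset_Suc by (intro concave_on_iter) blast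
  then have "strictly_concave_on {c..d} (F \<circ> iter (int n))"
    by (rule strictly_concave_on_compose[OF outer mono_F]) (auto simp: inj_on_def)
  then show ?thesis by (simp add: o_def add.commute[of 1] flip: iter_Suc)
qed

lemma closed_breaks: "closed (breaks n)"
proof -
  have "breaks n = (\<Union>j<n. (+) (iter (- int j) a) ` \<int>)"
    unfolding breaks_def act_def Ints_def by (auto simp: image_iff)
  then show ?thesis by (auto intro!: closed_UN closed_translation closed_Ints)
qed

lemma consecutive_breaks:
  assumes "0 < n" "x \<notin> breaks n"
  obtains c d where "c \<in> breaks n" "d \<in> breaks n" "c < x" "x < d" "{c<..<d} \<inter> breaks n = {}"
proof -
  have "a + of_int m \<in> breaks n" for m
    using breaksI[OF \<open>0 < n\<close>] by (simp add: act_def)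
  moreover have "a + of_int \<lfloor>x - a\<rfloor> \<le> x" "x \<le> a + of_int \<lceil>x - a\<rceil>" by linarith+
  ultimately show ?thesis using closed_gap[OF closed_breaks assms(2)] that by metis
qed

end

locale rational_concave_circle_map =
  rational_circle_map F f p q P r s + concave_lift F a K for F f p q P r s a K
begin

definition defect :: "real \<Rightarrow> real" where
  "defect x = ret 1 x - x"

lemma defect_pos_iff: "0 < defect x \<longleftrightarrow> x < ret 1 x"
  and defect_neg_iff: "defect x < 0 \<longleftrightarrow> ret 1 x < x"
  and defect_eq_0_iff: "defect x = 0 \<longleftrightarrow> x \<in> per"
  by (auto simp: defect_def per_def)

lemma defect_act_pos_iff: "0 < defect (act k m x) \<longleftrightarrow> 0 < defect x"
  by (simp add: defect_pos_iff ret_act)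

lemma continuous_on_defect: "continuous_on A defect"
  unfolding defect_def by (intro continuous_intros continuous_on_ret)

lemma concave_on_defect:
  assumes "{c<..<d} \<inter> breaks q = {}"
  shows "concave_on {c..d} defect"
proof -
  have "defect = (\<lambda>x. iter (int q) x - (x + of_int P))"
    by (auto simp: defect_def ret_def act_def)
  moreover have "convex_on {c..d} (\<lambda>x. x + of_int P)"
    by (intro convex_on_add) (simp_all add: convex_on_ident convex_on_const)
  ultimately show ?thesis using concave_on_diff[OF concave_on_iter[OF assms]] by simp
qed

lemma break_free_interval_per_dichotomy:
  assumes "{c<..<d} \<inter> breaks q = {}" "c \<in> per" "d \<in> per"
  shows "(\<forall>x\<in>{c<..<d}. 0 < defect x) \<or> {c..d} \<subseteq> per"
proof (rule disjCI)
  note conc = concave_on_defect[OF assms(1)]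
  have ends: "defect c = 0" "defect d = 0" using assms by (simp_all add: defect_eq_0_iff)
  assume "\<not> {c..d} \<subseteq> per"
  then obtain w where w: "w \<in> {c<..<d}" "defect w \<noteq> 0"
    using ends by (fastforce simp: order.order_iff_strict simp flip: defect_eq_0_iff)
  then have "0 < defect w" using concave_on_ge_min[OF conc, of w] ends by simp
  show "\<forall>x\<in>{c<..<d}. 0 < defect x"
  proof
    fix x assume "x \<in> {c<..<d}"
    then consider "x \<in> open_segment c w" | "x = w" | "x \<in> open_segment d w"
      using w(1) by (cases x w rule: linorder_cases) (auto simp: open_segment_eq_real_ivl)
    then show "0 < defect x"
      using concave_on_pos_open_segment[OF conc, of c w x] concave_on_pos_open_segment[OF conc, of d w x]
        w(1) \<open>0 < defect w\<close> ends by cases auto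
  qed
qed

lemma strict_break_free_interval_not_subset_per:
  assumes "strictly_concave_on {a..a + 1} F" "{c<..<d} \<inter> breaks q = {}" "c < d"
  shows "\<not> {c..d} \<subseteq> per"
proof
  assume "{c..d} \<subseteq> per"
  moreover have "(c + d) / 2 \<in> {c..d}" "c \<in> {c..d}" "d \<in> {c..d}" using \<open>c < d\<close> by auto
  ultimately have "c \<in> per" "d \<in> per" "(c + d) / 2 \<in> per" by blast+
  moreover obtain n where "q = Suc n" using q_pos gr0_conv_Suc by blast
  then have "strictly_concave_on {c..d} (iter (int q))"
    using strictly_concave_on_iter_Suc assms by blast
  from strictly_concave_onD[OF this, of c d "1/2"]
  have "(iter (int q) c + iter (int q) d) / 2 < iter (int q) ((c + d) / 2)"
    using \<open>c < d\<close> by (simp add: add_divide_distrib)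
  ultimately show False by (simp add: mem_per_iff field_simps)
qed

lemma breaks_between_per_translates:
  assumes "l \<in> per" "u \<in> per" "l \<le> a" "a \<le> u"
  shows "{u<..<step 1 l} \<inter> breaks q = {}"
proof -
  have "act k m a \<notin> {u<..<step 1 l}" for k m
  proof -
    define i where "i = k * P + m * int q"
    have "act k m l = step i l" "act k m u = step i u"
      unfolding i_def act_eq_step_ret by (simp_all add: ret_per assms)
    then have between: "step i l \<le> act k m a" "act k m a \<le> step i u"
      using assms(3,4) by (metis act_le_iff)+
    show ?thesis
    proof (cases "i \<le> 0")
      case True
      then have "step i u \<le> u" using step_index_le_iff[of i u 0] by simp
      then show ?thesis using between(2) by auto
    next
      case False
      then have "step 1 l \<le> step i l" by (simp add: step_index_le_iff)
      then show ?thesis using between(1) by auto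
    qed
  qed
  then show ?thesis by (auto simp: breaks_def)
qed

lemma dichotomy_if_break_between_per:
  assumes "l \<in> per" "u \<in> per" "l \<le> a" "a \<le> u" "u \<le> step 1 l"
    and neg: "\<And>x. x \<in> {l<..<u} \<Longrightarrow> defect x < 0"
  shows "(case_a f p q \<or> case_b f p q) \<and> (strictly_concave_on {a..a + 1} F \<longrightarrow> case_a f p q)"
proof -
  note break_free = breaks_between_per_translates[OF assms(1-4)]
  have left: "ret 1 x < x" if "x \<in> {step 1 l<..<step 1 u}" for x
  proof -
    have "step (- 1) x \<in> {l<..<u}"
      using that step_less_iff[of 1 l "step (- 1) x"] step_less_iff[of 1 "step (- 1) x" u] by simp
    then show ?thesis using neg[of "step (- 1) x"] by (simp add: defect_neg_iff ret_step)
  qed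
  consider "\<forall>x\<in>{u<..<step 1 l}. 0 < defect x" | "u < step 1 l" "{u..step 1 l} \<subseteq> per"
    using break_free_interval_per_dichotomy[OF break_free] assms by fastforce
  then show ?thesis
  proof cases
    case 1
    then have "case_a f p q"
      using assms left by (intro case_aI[of u "step 1 l"]) (auto simp: defect_pos_iff)
    then show ?thesis by blast
  next
    case 2
    then have "case_b f p q"
      using assms left by (intro case_bI[of u "step 1 l"]) auto
    then show ?thesis
      using strict_break_free_interval_not_subset_per[OF _ break_free] 2 by blast
  qed
qed

lemma defect_break_neg:
  assumes "a \<notin> per"
  shows "defect a < 0"
proof (rule ccontr)
  assume "\<not> defect a < 0"
  then have "0 < defect a" using assms defect_eq_0_iff[of a] by linarith
  then have pos: "0 < defect b" if "b \<in> breaks q" for b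
    using that by (auto simp: breaks_def defect_act_pos_iff)
  obtain y where "y \<in> per" using per_nonempty by blast
  then have "defect y = 0" by (simp add: defect_eq_0_iff)
  then have "y \<notin> breaks q" using pos[of y] by auto
  then obtain c d
    where consecutive: "c \<in> breaks q" "d \<in> breaks q" "c < y" "y < d" "{c<..<d} \<inter> breaks q = {}"
    using consecutive_breaks q_pos by blast
  then have "min (defect c) (defect d) \<le> defect y"
    by (intro concave_on_ge_min[OF concave_on_defect]) auto
  then show False using pos[OF consecutive(1)] pos[OF consecutive(2)] \<open>defect y = 0\<close> by simp
qed

lemma per_gap:
  assumes "x \<notin> per"
  obtains l u where "l \<in> per" "u \<in> per" "l < x" "x < u" "{l<..<u} \<inter> per = {}"
proof -
  obtain y where "y \<in> per" using per_nonempty by blast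
  then have "act 0 k y \<in> per" for k by simp
  then have "y + of_int k \<in> per" for k by (simp add: act_def)
  moreover have "y + of_int \<lfloor>x - y\<rfloor> \<le> x" "x \<le> y + of_int \<lceil>x - y\<rceil>" by linarith+
  ultimately show ?thesis using closed_gap[OF closed_per assms] that by metis
qed

lemma defect_neg_on_gap:
  assumes "{l<..<u} \<inter> per = {}" "x \<in> {l<..<u}" "defect x < 0" "y \<in> {l<..<u}"
  shows "defect y < 0"
proof (rule ccontr)
  assume "\<not> defect y < 0"
  moreover have "connected (defect ` {l<..<u})"
    by (intro connected_continuous_image continuous_on_defect) simp
  ultimately have "0 \<in> defect ` {l<..<u}"
    using assms connectedD_interval[of "defect ` {l<..<u}" "defect x" "defect y" 0] by auto
  then show False using assms(1) defect_eq_0_iff by fastforce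
qed

lemma rational_dichotomy:
  "(case_a f p q \<or> case_b f p q) \<and> (strictly_concave_on {a..a + 1} F \<longrightarrow> case_a f p q)"
proof (cases "a \<in> per")
  case True
  then show ?thesis
    using step_index_le_iff[of 0 a 1] by (intro dichotomy_if_break_between_per[of a a]) auto
next
  case False
  then obtain l u where around: "l \<in> per" "u \<in> per" "l < a" "a < u" and gap: "{l<..<u} \<inter> per = {}"
    by (rule per_gap)
  have "step 1 l \<notin> {l<..<u}" using around(1) gap by auto
  moreover have "l < step 1 l" using step_index_less[of 0 1 l] by simp
  ultimately have "u \<le> step 1 l" by simp
  then show ?thesis
    using around defect_neg_on_gap[OF gap _ defect_break_neg[OF False]]
    by (intro dichotomy_if_break_between_per[of l u]) auto
qed

end

section \<open>The wave billiard\<close>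

lemma diff_round_mem: "x - of_int (round x) \<in> {-1/2..1/2::real}"
  using of_int_round_abs_le[of x] unfolding atLeastAtMost_iff by linarith

lemma per_ext_eq_round: "per_ext b x = b (x - of_int (round x))"
  by (simp add: per_ext_def round_def)

lemma per_ext_shift: "per_ext b (x + 1) = per_ext b x"
proof -
  have "\<lfloor>x + 1 + 1/2\<rfloor> = \<lfloor>x + 1/2\<rfloor> + 1" by linarith
  then show ?thesis by (simp add: per_ext_def)
qed

locale wave_table =
  fixes b :: "real \<Rightarrow> real" and \<theta> db :: real
  assumes b_pos: "\<And>x. x \<in> {-1/2..1/2} \<Longrightarrow> 0 < b x"
    and b_even: "\<And>x. x \<in> {-1/2..1/2} \<Longrightarrow> b (- x) = b x"
    and b_concave: "concave_on {-1/2..1/2} b"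
    and b_noninc: "\<And>x y. 0 \<le> x \<Longrightarrow> x \<le> y \<Longrightarrow> y \<le> 1/2 \<Longrightarrow> b y \<le> b x"
    and b_deriv: "(b has_real_derivative db) (at (-1/2) within {-1/2..1/2})"
    and theta: "arctan db < \<theta>" "\<theta> < pi / 2"
begin

lemma db_nonneg: "0 \<le> db"
  using concave_on_le_left_tangent[OF b_concave b_deriv, of "-1/2" 0] b_noninc[of 0 "1/2"] b_even[of "1/2"]
  by simp

lemma sin_pos: "0 < sin \<theta>" and cos_pos: "0 < cos \<theta>"
proof -
  have "0 \<le> arctan db" using db_nonneg by simp
  then have "0 < \<theta>" using theta(1) by linarith
  then show "0 < sin \<theta>" "0 < cos \<theta>"
    using theta(2) by (auto intro!: sin_gt_zero cos_gt_zero_pi)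
qed

lemma cot_pos: "0 < cot \<theta>"
  using sin_pos cos_pos by (simp add: cot_def)

definition \<kappa> :: real where "\<kappa> = db * cot \<theta>"

lemma \<kappa>_nonneg: "0 \<le> \<kappa>"
  using db_nonneg cot_pos by (simp add: \<kappa>_def)

lemma \<kappa>_less_1: "\<kappa> < 1"
proof -
  have "tan (arctan db) < tan \<theta>"
    using theta arctan_lbound[of db] by (intro tan_monotone) auto
  then have "db < sin \<theta> / cos \<theta>" by (simp only: tan_arctan) (simp add: tan_def)
  then show ?thesis using sin_pos cos_pos by (simp add: \<kappa>_def cot_def field_simps)
qed

abbreviation B :: "real \<Rightarrow> real" where "B \<equiv> per_ext b"

lemma B_pos: "0 < B x"
  unfolding per_ext_eq_round by (intro b_pos diff_round_mem)

lemma B_eq_b: "B x = b x" if "x \<in> {-1/2..1/2}"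
proof (cases "x = 1/2")
  case True
  then show ?thesis using b_even[of "1/2"] unfolding True per_ext_def by simp
next
  case False
  then have "\<lfloor>x + 1/2\<rfloor> = 0" using that by (simp add: floor_eq_iff)
  then show ?thesis by (simp add: per_ext_def)
qed

lemma b_Lipschitz:
  assumes "0 \<le> u" "u \<le> v" "v \<le> 1/2"
  shows "\<bar>b u - b v\<bar> \<le> db * (v - u)"
proof (cases "u = v")
  case False
  then have "b (- u) - b (- v) \<le> db * (- u - - v)"
    using assms by (intro concave_on_le_left_tangent[OF b_concave b_deriv]) auto
  then show ?thesis using b_noninc[OF assms] b_even[of u] b_even[of v] assms by simp
qed simp

lemma B_Lipschitz: "\<bar>B x - B y\<bar> \<le> db * \<bar>x - y\<bar>"
proof -
  have "B x = b (dist_Ints x)" for x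
    using diff_round_mem[of x] b_even[of "x - of_int (round x)"]
    by (auto simp: dist_Ints_def per_ext_eq_round abs_if)
  moreover have "\<bar>b (dist_Ints x) - b (dist_Ints y)\<bar> \<le> db * \<bar>dist_Ints x - dist_Ints y\<bar>"
    using b_Lipschitz[of "dist_Ints x" "dist_Ints y"] b_Lipschitz[of "dist_Ints y" "dist_Ints x"]
      dist_Ints_le_half
    by (cases "dist_Ints x \<le> dist_Ints y") (auto simp: abs_minus_commute dist_Ints_def)
  moreover have "\<dots> \<le> db * \<bar>x - y\<bar>"
    using dist_Ints_diff_le db_nonneg by (rule mult_left_mono)
  ultimately show ?thesis by simp
qed

lemma continuous_on_B: "continuous_on A B"
proof -
  have "db-lipschitz_on A B"
    using B_Lipschitz db_nonneg by (intro lipschitz_onI) (auto simp: dist_real_def)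
  then show ?thesis by (rule lipschitz_on_continuous_on)
qed

lemma concave_on_B: "concave_on {-1/2..1/2} B"
  using b_concave B_eq_b by (rule concave_on_cong)

text \<open>The flow line through the upper boundary point of abscissa \<open>X\<close> left the cross-section at
  \<open>dep X\<close> and next returns to it at \<open>arr X\<close>.\<close>

definition dep :: "real \<Rightarrow> real" where "dep X = X - cot \<theta> * B X"
definition arr :: "real \<Rightarrow> real" where "arr X = X + cot \<theta> * B X"

lemma cot_B_Lipschitz: "X \<le> Y \<Longrightarrow> \<bar>cot \<theta> * B Y - cot \<theta> * B X\<bar> \<le> \<kappa> * (Y - X)"
  using mult_left_mono[OF B_Lipschitz[of Y X], of "cot \<theta>"] cot_pos
  by (simp add: \<kappa>_def abs_mult ac_simps flip: right_diff_distrib)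

lemma dep_diff_bounds:
  assumes "X \<le> Y"
  shows "(1 - \<kappa>) * (Y - X) \<le> dep Y - dep X" "dep Y - dep X \<le> (1 + \<kappa>) * (Y - X)"
  using cot_B_Lipschitz[OF assms] by (simp_all add: dep_def algebra_simps abs_le_iff)

lemma arr_diff_bounds:
  assumes "X \<le> Y"
  shows "(1 - \<kappa>) * (Y - X) \<le> arr Y - arr X" "arr Y - arr X \<le> (1 + \<kappa>) * (Y - X)"
  using cot_B_Lipschitz[OF assms] by (simp_all add: arr_def algebra_simps abs_le_iff)

lemma strict_mono_dep: "strict_mono dep" and strict_mono_arr: "strict_mono arr"
  using expanding_imp_strict_mono[of "1 - \<kappa>"] dep_diff_bounds(1) arr_diff_bounds(1) \<kappa>_less_1 by simp_all

lemma surj_dep: "surj dep" and surj_arr: "surj arr"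
proof -
  have "continuous_on UNIV dep" "continuous_on UNIV arr"
    unfolding dep_def arr_def by (intro continuous_intros continuous_on_B)+
  then show "surj dep" "surj arr"
    using expanding_imp_surj[of "1 - \<kappa>"] dep_diff_bounds(1) arr_diff_bounds(1) \<kappa>_less_1 by simp_all
qed

lemma dep_shift: "dep (X + 1) = dep X + 1" and arr_shift: "arr (X + 1) = arr X + 1"
  by (simp_all add: dep_def arr_def per_ext_shift)

lemma convex_on_dep: "convex_on {-1/2..1/2} dep"
  unfolding dep_def using cot_pos concave_on_B
  by (intro convex_on_diff concave_on_cmul) (simp_all add: convex_on_ident)

lemma concave_on_arr: "concave_on {-1/2..1/2} arr"
  unfolding arr_def using cot_pos concave_on_B
  by (intro concave_on_add concave_on_cmul) (simp_all add: concave_on_ident)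

lemma strictly_concave_on_arr:
  assumes "strictly_concave_on {-1/2..1/2} b"
  shows "strictly_concave_on {-1/2..1/2} arr"
  unfolding strictly_concave_on_def
proof (intro ballI allI impI)
  fix X Y t :: real
  assume XY: "X \<in> {-1/2..1/2}" "Y \<in> {-1/2..1/2}" and t: "X \<noteq> Y \<and> 0 < t \<and> t < 1"
  define V where "V = t * X + (1 - t) * Y"
  have "V \<in> {-1/2..1/2}"
    using convexD[OF convex_real_interval(5) XY, of t "1 - t"] t by (simp add: V_def)
  then have "t * B X + (1 - t) * B Y < B V"
    using strictly_concave_onD[OF assms XY, of t] t XY by (simp add: B_eq_b V_def)
  then have "cot \<theta> * (t * B X + (1 - t) * B Y) < cot \<theta> * B V"
    using cot_pos by simp
  then show "t * arr X + (1 - t) * arr Y < arr (t * X + (1 - t) * Y)"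
    by (simp add: arr_def V_def algebra_simps)
qed

definition crossing :: "real \<Rightarrow> real" where "crossing = inv dep"

lemma dep_crossing [simp]: "dep (crossing x) = x"
  unfolding crossing_def using surj_dep by (rule surj_f_inv_f)

lemma crossing_dep [simp]: "crossing (dep X) = X"
  unfolding crossing_def using strict_mono_dep by (simp add: strict_mono_imp_inj_on)

lemma strict_mono_crossing: "strict_mono crossing"
  using strict_mono_dep by (metis dep_crossing strict_mono_less strict_monoI)

lemma crossing_shift: "crossing (x + 1) = crossing x + 1"
  by (metis crossing_dep dep_crossing dep_shift)

lemma crossing_fundamental_domain: "crossing ` {dep (-1/2)..dep (-1/2) + 1} \<subseteq> {-1/2..1/2}"
proof (rule image_subsetI)
  fix x assume "x \<in> {dep (-1/2)..dep (-1/2) + 1}"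
  then have "dep (-1/2) \<le> dep (crossing x)" "dep (crossing x) \<le> dep (1/2)"
    using dep_shift[of "-1/2"] by simp_all
  then show "crossing x \<in> {-1/2..1/2}"
    unfolding strict_mono_less_eq[OF strict_mono_dep] by simp
qed

lemma hit_time_eq: "hit_time b \<theta> x = B (crossing x) / sin \<theta>"
proof -
  define X where "X = crossing x"
  have x: "x = X - B X / sin \<theta> * cos \<theta>"
    using dep_crossing[of x] by (simp add: X_def dep_def cot_def mult.commute)
  have "B (x + t * cos \<theta>) \<le> t * sin \<theta> \<longleftrightarrow> B X / sin \<theta> \<le> t" for t
  proof -
    define Y where "Y = x + t * cos \<theta>"
    have "B Y \<le> t * sin \<theta> \<longleftrightarrow> cot \<theta> * B Y \<le> cot \<theta> * (t * sin \<theta>)"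
      using cot_pos by simp
    also have "cot \<theta> * (t * sin \<theta>) = t * cos \<theta>" using sin_pos by (simp add: cot_def)
    also have "cot \<theta> * B Y \<le> t * cos \<theta> \<longleftrightarrow> dep X \<le> dep Y"
      unfolding dep_def[of Y] by (simp add: X_def Y_def)
    also have "\<dots> \<longleftrightarrow> B X / sin \<theta> * cos \<theta> \<le> t * cos \<theta>"
      unfolding strict_mono_less_eq[OF strict_mono_dep] by (simp add: Y_def x)
    also have "\<dots> \<longleftrightarrow> B X / sin \<theta> \<le> t" using cos_pos by (rule mult_le_cancel_right_pos)
    finally show ?thesis by (simp add: Y_def)
  qed
  moreover have "0 < B X / sin \<theta>" using B_pos sin_pos by simp
  ultimately have "{t. 0 \<le> t \<and> B (x + t * cos \<theta>) \<le> t * sin \<theta>} = {B X / sin \<theta>..}"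
    by auto
  then show ?thesis by (simp add: hit_time_def X_def)
qed

lemma wave_lift_eq: "wave_lift b \<theta> = arr \<circ> crossing"
proof
  fix x
  have "x + hit_time b \<theta> x * cos \<theta> = crossing x"
    using dep_crossing[of x] unfolding hit_time_eq by (simp add: dep_def cot_def mult.commute)
  then show "wave_lift b \<theta> x = (arr \<circ> crossing) x"
    by (simp add: wave_lift_def Let_def arr_def cot_def mult.commute)
qed

lemma circle_lift_wave_lift: "circle_lift (wave_lift b \<theta>)"
proof
  show "strict_mono (wave_lift b \<theta>)"
    unfolding wave_lift_eq using strict_mono_arr strict_mono_crossing by (rule strict_mono_o)
  have "surj crossing" by (metis crossing_dep surjI)
  then show "surj (wave_lift b \<theta>)"
    unfolding wave_lift_eq using surj_arr by (rule comp_surj)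
  show "wave_lift b \<theta> (x + 1) = wave_lift b \<theta> x + 1" for x
    by (simp add: wave_lift_eq crossing_shift arr_shift)
qed

lemma wave_lift_slope_bounds:
  assumes "x < y"
  shows "(y - x) / ((1 + \<kappa>) / (1 - \<kappa>)) \<le> wave_lift b \<theta> y - wave_lift b \<theta> x"
    and "wave_lift b \<theta> y - wave_lift b \<theta> x \<le> (1 + \<kappa>) / (1 - \<kappa>) * (y - x)"
proof -
  define X Y where "X = crossing x" and "Y = crossing y"
  have "X \<le> Y" using assms strict_mono_crossing by (simp add: X_def Y_def strict_mono_less_eq)
  have "y - x \<le> (1 + \<kappa>) * (Y - X)" "(1 - \<kappa>) * (Y - X) \<le> y - x"
    using dep_diff_bounds[OF \<open>X \<le> Y\<close>] by (simp_all add: X_def Y_def)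
  then have "(y - x) / (1 + \<kappa>) \<le> Y - X" "Y - X \<le> (y - x) / (1 - \<kappa>)"
    using \<kappa>_nonneg \<kappa>_less_1 by (simp_all add: field_simps)
  then have "(1 - \<kappa>) * ((y - x) / (1 + \<kappa>)) \<le> (1 - \<kappa>) * (Y - X)"
    "(1 + \<kappa>) * (Y - X) \<le> (1 + \<kappa>) * ((y - x) / (1 - \<kappa>))"
    using \<kappa>_nonneg \<kappa>_less_1 by (intro mult_left_mono; simp)+
  then show "(y - x) / ((1 + \<kappa>) / (1 - \<kappa>)) \<le> wave_lift b \<theta> y - wave_lift b \<theta> x"
    "wave_lift b \<theta> y - wave_lift b \<theta> x \<le> (1 + \<kappa>) / (1 - \<kappa>) * (y - x)"
    using arr_diff_bounds[OF \<open>X \<le> Y\<close>] by (simp_all add: wave_lift_eq X_def Y_def mult.commute)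
qed

lemma concave_on_crossing: "concave_on {dep (-1/2)..dep (-1/2) + 1} crossing"
  using crossing_fundamental_domain
  by (rule concave_on_inverse[OF convex_on_dep strict_mono_dep dep_crossing convex_real_interval(5)])

lemma concave_on_wave_lift: "concave_on {dep (-1/2)..dep (-1/2) + 1} (wave_lift b \<theta>)"
  unfolding wave_lift_eq
  by (rule concave_on_compose[OF concave_on_arr strict_mono_mono[OF strict_mono_arr]
        concave_on_crossing crossing_fundamental_domain])

lemma strictly_concave_on_wave_lift:
  assumes "strictly_concave_on {-1/2..1/2} b"
  shows "strictly_concave_on {dep (-1/2)..dep (-1/2) + 1} (wave_lift b \<theta>)"
  unfolding wave_lift_eq
  by (rule strictly_concave_on_compose[OF strictly_concave_on_arr[OF assms]
        strict_mono_mono[OF strict_mono_arr] concave_on_crossing crossing_fundamental_domain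
        strict_mono_imp_inj_on[OF strict_mono_crossing]])

sublocale circle_map "wave_lift b \<theta>" "wave_map b \<theta>"
  using circle_lift.circle_map_Arg[OF circle_lift_wave_lift] by (simp add: wave_map_def[abs_def])

sublocale concave_lift "wave_lift b \<theta>" "dep (-1/2)" "(1 + \<kappa>) / (1 - \<kappa>)"
  using \<kappa>_nonneg \<kappa>_less_1 wave_lift_slope_bounds concave_on_wave_lift by unfold_locales simp_all

lemma rot_num_eq: "rot_num (wave_lift b \<theta>) = frac trans_num"
  by (simp add: rot_num_def trans_num_def)

lemma irrational_rotation_number:
  assumes "frac trans_num \<notin> \<rat>"
  shows "\<exists>h h'. homeomorphism Tcirc Tcirc h h' \<and>
      (\<forall>z\<in>Tcirc. h (wave_map b \<theta> z) = cis (2 * pi * frac trans_num) * h z)"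
    and "\<forall>z\<in>Tcirc. closure (full_orbit (wave_map b \<theta>) z) = Tcirc"
proof -
  have irr: "trans_num \<notin> \<rat>" using assms unfolding frac_def by (metis Rats_diff Rats_of_int)
  have "cis (2 * pi * frac trans_num) = circ trans_num"
    using circ_shift[of trans_num "- \<lfloor>trans_num\<rfloor>"] by (simp add: circ_def frac_def)
  then show "\<exists>h h'. homeomorphism Tcirc Tcirc h h' \<and>
      (\<forall>z\<in>Tcirc. h (wave_map b \<theta> z) = cis (2 * pi * frac trans_num) * h z)"
    using conjugate_to_rotation[OF irr strict_mono_semiconj[OF irr]] by simp
  show "\<forall>z\<in>Tcirc. closure (full_orbit (wave_map b \<theta>) z) = Tcirc"
    using full_orbit_dense[OF irr strict_mono_semiconj[OF irr]] by blast
qed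

lemma rational_rotation_number:
  assumes "0 < q" "coprime p q" "frac trans_num = real p / real q"
  shows "case_a (wave_map b \<theta>) p q \<or> case_b (wave_map b \<theta>) p q"
    and "strictly_concave_on {-1/2..1/2} b \<Longrightarrow> case_a (wave_map b \<theta>) p q"
proof -
  define P where "P = \<lfloor>trans_num\<rfloor> * int q + int p"
  have "gcd (int q) P = 1"
    unfolding P_def gcd_add_mult using assms(2) by (simp add: gcd.commute)
  then obtain r s where bezout: "r * P + s * int q = 1"
    using bezout_int[of P "int q"] by (auto simp: gcd.commute)
  have "trans_num = real p / real q + of_int \<lfloor>trans_num\<rfloor>" using assms(3) by (simp add: frac_def)
  then have "real q * trans_num = real q * (real p / real q + of_int \<lfloor>trans_num\<rfloor>)" by simp
  then have "real q * trans_num = of_int P" using assms(1) by (simp add: P_def distrib_left)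
  then interpret rational_concave_circle_map
    "wave_lift b \<theta>" "wave_map b \<theta>" p q P r s "dep (-1/2)" "(1 + \<kappa>) / (1 - \<kappa>)"
    by unfold_locales (use assms(1) bezout in \<open>auto simp: P_def\<close>)
  show "case_a (wave_map b \<theta>) p q \<or> case_b (wave_map b \<theta>) p q" using rational_dichotomy by blast
  show "case_a (wave_map b \<theta>) p q" if "strictly_concave_on {-1/2..1/2} b"
    using rational_dichotomy strictly_concave_on_wave_lift[OF that] by blast
qed

end

theorem theorem2p2:
  fixes b :: "real \<Rightarrow> real" and \<theta> db :: real
  assumes b_pos: "\<forall>x\<in>{-1/2..1/2}. 0 < b x"
    and b_even: "\<forall>x\<in>{-1/2..1/2}. b (- x) = b x"
    and b_C1: "b piecewise_C1_differentiable_on {-1/2..1/2}"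
    and b_concave: "concave_on {-1/2..1/2} b"
    and b_noninc: "\<forall>x y. 0 \<le> x \<and> x \<le> y \<and> y \<le> 1/2 \<longrightarrow> b y \<le> b x"
    and b_deriv: "(b has_real_derivative db) (at (-1/2) within {-1/2..1/2})"
    and theta: "arctan db < \<theta>" "\<theta> < pi / 2"
  defines "f \<equiv> wave_map b \<theta>"
    and "\<rho> \<equiv> rot_num (wave_lift b \<theta>)"
  shows
    "(\<rho> \<notin> \<rat> \<longrightarrow>
        (\<exists>h h'. homeomorphism Tcirc Tcirc h h' \<and>
                (\<forall>z\<in>Tcirc. h (f z) = cis (2 * pi * \<rho>) * h z)) \<and>
        (\<forall>z\<in>Tcirc. closure (full_orbit f z) = Tcirc))
     \<and>
     (\<forall>p q :: nat. \<rho> \<in> \<rat> \<and>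
        ((0 < \<rho> \<and> 0 < p \<and> 0 < q \<and> coprime p q \<and> \<rho> = real p / real q) \<or>
         (\<rho> = 0 \<and> p = 0 \<and> q = 1)) \<longrightarrow>
        (case_a f p q \<or> case_b f p q) \<and>
        (strictly_concave_on {-1/2..1/2} b \<longrightarrow> case_a f p q))"
proof -
  interpret wave_table b \<theta> db
    by unfold_locales (use assms in auto)
  have irrational: "(\<exists>h h'. homeomorphism Tcirc Tcirc h h' \<and>
        (\<forall>z\<in>Tcirc. h (f z) = cis (2 * pi * \<rho>) * h z)) \<and>
      (\<forall>z\<in>Tcirc. closure (full_orbit f z) = Tcirc)" if "\<rho> \<notin> \<rat>"
    using irrational_rotation_number that unfolding f_def \<rho>_def rot_num_eq by blast
  have rational: "(case_a f p q \<or> case_b f p q) \<and> (strictly_concave_on {-1/2..1/2} b \<longrightarrow> case_a f p q)"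
    if "(0 < \<rho> \<and> 0 < p \<and> 0 < q \<and> coprime p q \<and> \<rho> = real p / real q) \<or> (\<rho> = 0 \<and> p = 0 \<and> q = 1)"
    for p q :: nat
  proof -
    have "0 < q" "coprime p q" "frac trans_num = real p / real q"
      using that by (auto simp: \<rho>_def rot_num_eq)
    then show ?thesis using rational_rotation_number unfolding f_def by blast
  qed
  from irrational rational show ?thesis by blast
qed

end
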